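(* For every integer $n$ with $7\le n\le 18$, the $n\times n$ queen graph $\mathcal{Q}_n$ satisfies $c(\mathcal{Q}_n)=3$.
   Context: The $n\times n$ queen graph $\mathcal{Q}_n$ has vertex set $\{1,\dots,n\}^2$, with two distinct vertices adjacent iff they lie in the same row, the same column, or on a common diagonal (i.e. their difference is a nonzero multiple of $(1,0)$, $(0,1)$, $(1,1)$ or $(1,-1)$). Cops and robbers on a graph $G$: a fixed number $k$ of cops are placed on vertices, then the robber chooses a vertex; players alternate turns, cops first, each moving along an edge or staying put. The cops win if some cop occupies the robber's vertex after finitely many turns. The cop number $c(G)$ is the least $k$ such that $k$ cops can always win. *)

theory Defs
  imports "Graph_Theory.Graph_Theory"
begin

section \<open>Queen graphs\<close>

text \<open>As everywhere in the library's theory of graphs, an undirected edge is represented by the two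
  opposite arcs.\<close>

definition queen_graph :: "nat \<Rightarrow> (int \<times> int) pair_pre_digraph" where
  "queen_graph n =
    (let V = {1..int n} \<times> {1..int n} in
     \<lparr> pverts = V,
       parcs = {(u, v). u \<in> V \<and> v \<in> V \<and>
         (\<exists>d \<in> {(1, 0), (0, 1), (1, 1), (1, -1)}. \<exists>t. t \<noteq> 0 \<and>
            fst v - fst u = t * fst d \<and> snd v - snd u = t * snd d)} \<rparr>)"

lemma pair_graph_queen_graph: "pair_graph (queen_graph n)"
proof
  have sub: "parcs (queen_graph n) \<subseteq> pverts (queen_graph n) \<times> pverts (queen_graph n)"
    by (auto simp: queen_graph_def Let_def)
  show fin: "finite (pverts (queen_graph n))"
    by (simp add: queen_graph_def Let_def)
  show "finite (parcs (queen_graph n))"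
    by (rule finite_subset[OF sub]) (use fin in simp)
  show "fst e \<in> pverts (queen_graph n)" "snd e \<in> pverts (queen_graph n)"
    if "e \<in> parcs (queen_graph n)" for e
    using sub that by auto
  show "fst e \<noteq> snd e" if "e \<in> parcs (queen_graph n)" for e
    using that by (auto simp: queen_graph_def Let_def)
  have "(v, u) \<in> parcs (queen_graph n)" if uv: "(u, v) \<in> parcs (queen_graph n)" for u v
  proof -
    have "\<exists>d \<in> {(1, 0), (0, 1), (1, 1), (1, -1)}. \<exists>t. t \<noteq> (0 :: int) \<and>
        fst v - fst u = t * fst d \<and> snd v - snd u = t * snd d"
      using uv unfolding queen_graph_def Let_def by force
    then obtain d t where "d \<in> {(1, 0), (0, 1), (1, 1), (1, -1)}" "t \<noteq> (0 :: int)"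
        "fst v - fst u = t * fst d" "snd v - snd u = t * snd d"
      by blast
    then have "\<exists>d \<in> {(1, 0), (0, 1), (1, 1), (1, -1)}. \<exists>t :: int. t \<noteq> 0 \<and>
            fst u - fst v = t * fst d \<and> snd u - snd v = t * snd d"
      by (intro bexI[of _ d] exI[of _ "- t"]) auto
    then show ?thesis
      using uv by (auto simp: queen_graph_def Let_def)
  qed
  then show "symmetric (with_proj (queen_graph n))"
    by (auto simp: symmetric_def intro: symI)
qed

section \<open>Cops and robbers\<close>

text \<open>Used for graphs in the sense of the locale \<^locale>\<open>pair_graph\<close>.\<close>

definition move :: "'a pair_pre_digraph \<Rightarrow> 'a \<Rightarrow> 'a \<Rightarrow> bool" where
  "move G u v \<longleftrightarrow> v = u \<or> u \<rightarrow>\<^bsub>G\<^esub> v"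

text \<open>\<open>r i\<close> is the robber's vertex after his \<open>i\<close>-th turn, \<open>r 0\<close> being his choice of a starting
  vertex. A play is never broken off: it is harmless to continue it after a capture, because
  \<open>captured\<close> below only asks for a capture at some time.\<close>

definition robber_play :: "'a pair_pre_digraph \<Rightarrow> (nat \<Rightarrow> 'a) \<Rightarrow> bool" where
  "robber_play G r \<longleftrightarrow> r 0 \<in> pverts G \<and> (\<forall>i. move G (r i) (r (Suc i)))"

text \<open>A strategy maps the vertices visited by the robber so far, in temporal order, to the list of
  the positions of the cops after their reply; its value at \<open>[]\<close> is their initial
  placement. Several cops may share a vertex.\<close>

type_synonym 'a strategy = "'a list \<Rightarrow> 'a list"

definition cops_at :: "'a strategy \<Rightarrow> (nat \<Rightarrow> 'a) \<Rightarrow> nat \<Rightarrow> 'a list" where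
  "cops_at \<sigma> r i = \<sigma> (map r [0..<i])"

definition cop_strategy :: "'a pair_pre_digraph \<Rightarrow> nat \<Rightarrow> 'a strategy \<Rightarrow> bool" where
  "cop_strategy G k \<sigma> \<longleftrightarrow>
     length (\<sigma> []) = k \<and> set (\<sigma> []) \<subseteq> pverts G \<and>
     (\<forall>r. robber_play G r \<longrightarrow>
        (\<forall>i. list_all2 (move G) (cops_at \<sigma> r i) (cops_at \<sigma> r (Suc i))))"

text \<open>The order of events is \<open>cops_at \<sigma> r 0\<close>, \<open>r 0\<close>, \<open>cops_at \<sigma> r 1\<close>, \<open>r 1\<close>, and so on. The two
  disjuncts are the robber entering a vertex held by a cop, and a cop moving to the robber.\<close>

definition captured :: "'a strategy \<Rightarrow> (nat \<Rightarrow> 'a) \<Rightarrow> bool" where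
  "captured \<sigma> r \<longleftrightarrow>
     (\<exists>i. r i \<in> set (cops_at \<sigma> r i) \<or> r i \<in> set (cops_at \<sigma> r (Suc i)))"

definition cops_win :: "'a pair_pre_digraph \<Rightarrow> nat \<Rightarrow> bool" where
  "cops_win G k \<longleftrightarrow> (\<exists>\<sigma>. cop_strategy G k \<sigma> \<and> (\<forall>r. robber_play G r \<longrightarrow> captured \<sigma> r))"

definition cop_number :: "'a pair_pre_digraph \<Rightarrow> nat" where
  "cop_number G = (LEAST k. cops_win G k)"

text \<open>On a finite graph the minimum is over a nonempty set.\<close>

lemma cops_win_card:
  assumes "finite (pverts G)"
  shows "cops_win G (card (pverts G))"
proof -
  obtain vs where vs: "set vs = pverts G" "distinct vs"
    using finite_distinct_list[OF assms] by blast
  have "cop_strategy G (card (pverts G)) (\<lambda>_. vs)"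
    using vs by (auto simp: cop_strategy_def cops_at_def move_def distinct_card[symmetric]
      intro: list_all2_refl)
  moreover have "captured (\<lambda>_. vs) r" if "robber_play G r" for r
    using that vs by (auto simp: captured_def cops_at_def robber_play_def)
  ultimately show ?thesis
    by (auto simp: cops_win_def)
qed

end

theory Submission
  imports Defs
begin

text \<open>Two cops do not suffice: on a board of side at least 7, whenever no cop stands on the robber's
  square, some square on one of his four lines is attacked by neither cop. A cop who is not on a given
  line attacks at most three of its squares, so a row or a column without cops has a safe square; the
  remaining case, with one cop on the row and the other on the column, is settled on the diagonals.

  Three cops suffice by an explicit strategy for each board size, found by retrograde analysis. It is
  recorded as a list of positions with the robber to move, up to symmetries of the board, such that
  every escape of the robber can be answered by moving to a symmetric copy of an earlier position.
  All that has to be computed is that the list has this property.\<close>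

section \<open>Moves on the queen graph\<close>

text \<open>The side 7 is what the counting needs, twice: two cops off a line attack up to six of
  its squares, and in the mixed case a robber next to a corner needs a diagonal with five further
  squares, because the two cops can cover four of them. The cops have to win against infinite plays
  with a strategy that is a function of the robber's history. This is reduced to a game with a
  bounded number of turns. Since an entry of the list cites earlier entries only, its place is such
  a bound, and replies that go round in circles are excluded. A robber who enters an attacked square
  is captured at once, so only unattacked squares have to be answered; the argument bottoms out in
  dead ends, entries with nothing to answer. The lists grow from one entry for side 7 to more than
  four hundred for side 18, and the check is done by rewriting with code equations, which is why
  they are shortened by symmetry and by the interchangeability of the cops.\<close>

definition aligned :: "int \<times> int \<Rightarrow> int \<times> int \<Rightarrow> bool" where
  "aligned u v \<longleftrightarrow> fst u = fst v \<or> snd u = snd v \<or>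
     fst u + snd u = fst v + snd v \<or> fst u + snd v = fst v + snd u"

lemma pverts_queen_graph [simp]: "pverts (queen_graph n) = {1..int n} \<times> {1..int n}"
  by (simp add: queen_graph_def Let_def)

text \<open>Eliminates the step length \<open>t\<close>: being a multiple of one of the four
  directions becomes one of the linear equations of \<open>aligned\<close>, so that attacks are
  linear integer arithmetic from here on.\<close>

lemma parcs_queen_graph_iff:
  "(u, v) \<in> parcs (queen_graph n) \<longleftrightarrow>
     u \<in> pverts (queen_graph n) \<and> v \<in> pverts (queen_graph n) \<and> u \<noteq> v \<and> aligned u v"
proof -
  have "(\<exists>d \<in> {(1, 0), (0, 1), (1, 1), (1, -1)}. \<exists>t. t \<noteq> 0 \<and>
            fst v - fst u = t * fst d \<and> snd v - snd u = t * snd d) \<longleftrightarrow> u \<noteq> v \<and> aligned u v"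
    by (auto simp: aligned_def prod_eq_iff)
  then show ?thesis
    by (simp add: queen_graph_def Let_def)
qed

text \<open>This direction also covers a \<open>u\<close> off the board, whose only move is to stay.
  The lower bound uses it for cops of which nothing but their number is known.\<close>

lemma move_queen_graph_imp_aligned: "move (queen_graph n) u v \<Longrightarrow> aligned u v"
  by (auto simp: move_def parcs_queen_graph_iff aligned_def)

lemma move_queen_graph_iff:
  assumes "u \<in> pverts (queen_graph n)"
  shows "move (queen_graph n) u v \<longleftrightarrow> v \<in> pverts (queen_graph n) \<and> aligned u v"
  using assms by (auto simp: move_def parcs_queen_graph_iff aligned_def)

section \<open>Evading two cops\<close>

text \<open>Pigeonhole on a list of forbidden values, which may repeat or lie outside the
  range.\<close>

lemma ex_not_in_list:
  fixes m :: int
  assumes "int (length js) < m"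
  obtains j where "j \<in> {1..m}" "j \<notin> set js"
proof -
  have "card (set js) < card {1..m}"
    using assms card_length[of js] by simp
  then have "\<not> {1..m} \<subseteq> set js"
    using card_mono[of "set js" "{1..m}"] by auto
  then show thesis
    using that by blast
qed

text \<open>The robber is at \<open>(x, y)\<close>, the cops at \<open>(x, y - p)\<close> and
  \<open>(x - q, y)\<close>. A cop meets a diagonal arm on its own side only at distance
  \<open>t\<close> with \<open>p = t\<close> (straight) or \<open>p = 2 * t\<close> (along a
  diagonal), and never an arm pointing away from it. By \<open>away\<close> the arm pointing away
  from both cops is empty, so the robber is on an edge, and then the other arms are too long to be
  covered.\<close>

lemma not_all_diagonals_attacked:
  fixes x y p q N :: int
  assumes N: "7 \<le> N" and xy: "1 \<le> x" "x \<le> N" "1 \<le> y" "y \<le> N"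
    and away: "\<not> (x + 1 \<le> N \<and> y + 1 \<le> N)"
    and p: "\<And>t. 0 < t \<Longrightarrow> x + t \<le> N \<Longrightarrow> 1 \<le> y - t \<Longrightarrow> p = t \<or> p = 2 * t"
    and q: "\<And>t. 0 < t \<Longrightarrow> 1 \<le> x - t \<Longrightarrow> y + t \<le> N \<Longrightarrow> q = t \<or> q = 2 * t"
    and pq: "\<And>t. 0 < t \<Longrightarrow> 1 \<le> x - t \<Longrightarrow> 1 \<le> y - t \<Longrightarrow> p = t \<or> p = 2 * t \<or> q = t \<or> q = 2 * t"
  shows False
proof -
  \<comment> \<open>One coordinate is \<open>N\<close>. Three squares on an arm seen by a single cop
    are too many. Two squares force that cop to distance 2, which leaves the squares at distances 3
    and 4 of the common arm to the other cop. Nearer the corner, the common arm itself has five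
    squares.\<close>
  consider "x = N" "y + 3 \<le> N" | "y = N" "x + 3 \<le> N" | "x = N" "y + 2 = N" | "y = N" "x + 2 = N"
    | "6 \<le> x" "6 \<le> y"
    using N xy away by linarith
  then show False
  proof cases
    case 1
    then show False
      using q[of 1] q[of 2] q[of 3] N by auto
  next
    case 2
    then show False
      using p[of 1] p[of 2] p[of 3] N by auto
  next
    case 3
    then show False
      using q[of 1] q[of 2] pq[of 3] pq[of 4] N by auto
  next
    case 4
    then show False
      using p[of 1] p[of 2] pq[of 3] pq[of 4] N by auto
  next
    case 5
    obtain t where "t \<in> {1..5}" "t \<notin> set [p, p div 2, q, q div 2]"
      by (rule ex_not_in_list[of "[p, p div 2, q, q div 2]" 5]) auto
    then show False
      using pq[of t] 5 by auto
  qed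
qed

lemma ex_safe_diagonal_square:
  fixes n :: nat
  assumes "7 \<le> n" and r: "x \<in> {1..int n}" "y \<in> {1..int n}" and "a \<noteq> x" "b \<noteq> y"
  shows "\<exists>s \<in> {1..int n} \<times> {1..int n}. aligned (x, y) s \<and> \<not> aligned (x, b) s \<and> \<not> aligned (a, y) s"
proof (rule ccontr)
  assume H: "\<not> ?thesis"
  \<comment> \<open>Reflections that put both cops at coordinates smaller than the robber's, so that
    one of four configurations is enough.\<close>
  define X where "X = (if a < x then x else int n + 1 - x)"
  define Y where "Y = (if b < y then y else int n + 1 - y)"
  \<comment> \<open>The pair \<open>f\<close>, \<open>g\<close> names a diagonal arm:
    \<open>f = 1\<close> points towards the cop at \<open>(a, y)\<close>, \<open>g = 1\<close>
    towards the cop at \<open>(x, b)\<close>.\<close>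
  have attacked: "g = 1 \<and> (\<bar>b - y\<bar> = t \<or> \<bar>b - y\<bar> = 2 * t) \<or> f = 1 \<and> (\<bar>a - x\<bar> = t \<or> \<bar>a - x\<bar> = 2 * t)"
    if fg: "f \<in> {1, -1}" "g \<in> {1, -1}" and t: "0 < t"
      "1 \<le> X - f * t" "X - f * t \<le> int n" "1 \<le> Y - g * t" "Y - g * t \<le> int n" for f g t
  proof -
    \<comment> \<open>The square at distance \<open>t\<close> on this arm, in the original
      coordinates.\<close>
    define u where "u = (if a < x then x - f * t else x + f * t)"
    define v where "v = (if b < y then y - g * t else y + g * t)"
    have uv: "u \<noteq> x" "v \<noteq> y" "u - x = v - y \<or> u - x = y - v"
      using fg t(1) by (auto simp: u_def v_def)
    have "u \<in> {1..int n}" "v \<in> {1..int n}"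
      using t by (simp_all add: u_def v_def X_def Y_def split: if_splits)
    moreover have "aligned (x, y) (u, v)"
      using uv(3) by (auto simp: aligned_def)
    ultimately consider "aligned (x, b) (u, v)" | "aligned (a, y) (u, v)"
      using H by blast
    then show ?thesis
    proof cases
      case 1
      then have "b - y = v - y \<or> b - y = 2 * (v - y)"
        using uv assms(5) by (auto simp: aligned_def)
      then show ?thesis
        using fg(2) t(1) assms(5) by (auto simp: v_def split: if_splits)
    next
      case 2
      then have "a - x = u - x \<or> a - x = 2 * (u - x)"
        using uv assms(4) by (auto simp: aligned_def)
      then show ?thesis
        using fg(1) t(1) assms(4) by (auto simp: u_def split: if_splits)
    qed
  qed
  show False
  proof (rule not_all_diagonals_attacked[of "int n" X Y "\<bar>b - y\<bar>" "\<bar>a - x\<bar>"])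
    show "7 \<le> int n" "1 \<le> X" "X \<le> int n" "1 \<le> Y" "Y \<le> int n"
      using assms(1) r by (auto simp: X_def Y_def)
    \<comment> \<open>For \<open>f = g = -1\<close> both disjuncts of \<open>attacked\<close> fail,
      so the first square of that arm must be off the board.\<close>
    then show "\<not> (X + 1 \<le> int n \<and> Y + 1 \<le> int n)"
      using attacked[of "-1" "-1" 1] by auto
    fix t :: int
    assume "0 < t"
    then show "\<bar>b - y\<bar> = t \<or> \<bar>b - y\<bar> = 2 * t" if "X + t \<le> int n" "1 \<le> Y - t"
      using attacked[of "-1" 1 t] that \<open>1 \<le> X\<close> \<open>Y \<le> int n\<close> by auto
    show "\<bar>a - x\<bar> = t \<or> \<bar>a - x\<bar> = 2 * t" if "1 \<le> X - t" "Y + t \<le> int n"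
      using attacked[of 1 "-1" t] that \<open>0 < t\<close> \<open>X \<le> int n\<close> \<open>1 \<le> Y\<close> by auto
    show "\<bar>b - y\<bar> = t \<or> \<bar>b - y\<bar> = 2 * t \<or> \<bar>a - x\<bar> = t \<or> \<bar>a - x\<bar> = 2 * t"
      if "1 \<le> X - t" "1 \<le> Y - t"
      using attacked[of 1 1 t] that \<open>0 < t\<close> \<open>X \<le> int n\<close> \<open>Y \<le> int n\<close> by auto
  qed
qed

lemma ex_safe_square:
  fixes n :: nat
  assumes "7 \<le> n" "r \<in> pverts (queen_graph n)" "c \<noteq> r" "d \<noteq> r"
  shows "\<exists>s \<in> pverts (queen_graph n). aligned r s \<and> \<not> aligned c s \<and> \<not> aligned d s"
proof -
  obtain x y where r: "r = (x, y)" by (cases r)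
  obtain a b where c: "c = (a, b)" by (cases c)
  obtain a' b' where d: "d = (a', b')" by (cases d)
  have xy: "x \<in> {1..int n}" "y \<in> {1..int n}"
    using assms(2) r by auto
  \<comment> \<open>If neither the row nor the column is without cops, some cop is on the row; being
    different from the robber it is off the column, so the column is held by the other cop.\<close>
  consider (row) "a \<noteq> x" "a' \<noteq> x" | (column) "b \<noteq> y" "b' \<noteq> y"
    | (row_column) "a = x" "b' = y" | (column_row) "b = y" "a' = x"
    using assms(3,4) by (auto simp: r c d)
  then show ?thesis
  proof cases
    case row
    \<comment> \<open>For each cop: the places where its column and its two diagonals meet the
      robber's row. Six values face at least seven squares.\<close>
    obtain j where j: "j \<in> {1..int n}" "j \<notin> set [b, a + b - x, x + b - a, b', a' + b' - x, x + b' - a']"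
      by (rule ex_not_in_list[of "[b, a + b - x, x + b - a, b', a' + b' - x, x + b' - a']" "int n"])
        (use assms(1) in auto)
    then have "\<not> aligned c (x, j)" "\<not> aligned d (x, j)"
      using row by (auto simp: aligned_def c d)
    moreover have "aligned r (x, j)"
      by (simp add: aligned_def r)
    ultimately show ?thesis
      using xy j(1) by (intro bexI[of _ "(x, j)"]) auto
  next
    case column
    obtain j where j: "j \<in> {1..int n}" "j \<notin> set [a, a + b - y, y + a - b, a', a' + b' - y, y + a' - b']"
      by (rule ex_not_in_list[of "[a, a + b - y, y + a - b, a', a' + b' - y, y + a' - b']" "int n"])
        (use assms(1) in auto)
    then have "\<not> aligned c (j, y)" "\<not> aligned d (j, y)"
      using column by (auto simp: aligned_def c d)
    moreover have "aligned r (j, y)"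
      by (simp add: aligned_def r)
    ultimately show ?thesis
      using xy j(1) by (intro bexI[of _ "(j, y)"]) auto
  next
    case row_column
    then show ?thesis
      using ex_safe_diagonal_square[OF assms(1) xy, of a' b] assms(3,4) by (auto simp: r c d)
  next
    case column_row
    then show ?thesis
      using ex_safe_diagonal_square[OF assms(1) xy, of a b'] assms(3,4) by (auto simp: r c d)
  qed
qed

section \<open>From evading one turn to an infinite play of the robber\<close>

lemma not_cops_win_if_evadable:
  assumes start: "\<And>cs. length cs = k \<Longrightarrow> \<exists>s \<in> pverts G. \<forall>c \<in> set cs. \<not> move G c s"
    and evade: "\<And>cs r. length cs = k \<Longrightarrow> r \<in> pverts G \<Longrightarrow> r \<notin> set cs \<Longrightarrow>
      \<exists>s \<in> pverts G. move G r s \<and> (\<forall>c \<in> set cs. \<not> move G c s)"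
  shows "\<not> cops_win G k"
proof
  assume "cops_win G k"
  then obtain \<sigma> where \<sigma>: "cop_strategy G k \<sigma>" and win: "\<And>r. robber_play G r \<Longrightarrow> captured \<sigma> r"
    by (auto simp: cops_win_def)
  define safe where "safe cs s \<longleftrightarrow> s \<in> pverts G \<and> (\<forall>c \<in> set cs. \<not> move G c s)" for cs s
  \<comment> \<open>Staying put where no safe move exists makes the construction a legal play before
    any safety is known. Only against legal plays are the cops bound to the rules, and the safety
    argument needs that.\<close>
  define reply where "reply h = (if \<exists>s. move G (last h) s \<and> safe (\<sigma> h) s
    then SOME s. move G (last h) s \<and> safe (\<sigma> h) s else last h)" for h
  \<comment> \<open>The recursion builds whole histories, because \<open>\<sigma>\<close> takes the
    history and not the current square.\<close>
  define h where "h = rec_nat [SOME s. safe (\<sigma> []) s] (\<lambda>_ h. h @ [reply h])"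
  define r where "r i = last (h i)" for i
  have h_Suc: "h (Suc i) = h i @ [reply (h i)]" for i
    by (simp add: h_def)
  have h_eq: "h i = map r [0..<Suc i]" for i
  proof (induction i)
    case 0
    show ?case by (simp add: r_def h_def)
  next
    case (Suc i)
    then show ?case by (simp add: h_Suc r_def)
  qed
  have "\<exists>s. safe (\<sigma> []) s"
    using start[of "\<sigma> []"] \<sigma> by (auto simp: safe_def cop_strategy_def)
  then have r0: "safe (\<sigma> []) (r 0)"
    unfolding r_def h_def by (auto intro: someI_ex)
  have r_Suc: "r (Suc i) = reply (h i)" for i
    by (simp add: r_def h_Suc)
  have moves: "move G (r i) (r (Suc i))" for i
  proof (cases "\<exists>s. move G (last (h i)) s \<and> safe (\<sigma> (h i)) s")
    case True
    then show ?thesis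
      unfolding r_Suc reply_def if_P[OF True] using someI_ex[OF True] by (simp add: r_def)
  next
    case False
    then show ?thesis
      unfolding r_Suc reply_def if_not_P[OF False] by (simp add: move_def r_def)
  qed
  have play: "robber_play G r"
    using r0 moves by (simp add: robber_play_def safe_def)
  have cops: "list_all2 (move G) (cops_at \<sigma> r i) (cops_at \<sigma> r (Suc i))" for i
    using \<sigma> play by (simp add: cop_strategy_def)
  have len: "length (cops_at \<sigma> r i) = k" for i
  proof (induction i)
    case 0
    show ?case using \<sigma> by (simp add: cops_at_def cop_strategy_def)
  next
    case (Suc i)
    then show ?case using list_all2_lengthD[OF cops[of i]] by simp
  qed
  have missed: "r i \<notin> set (cops_at \<sigma> r (Suc i))" if "safe (cops_at \<sigma> r i) (r i)" for i
    using that cops[of i] by (metis in_set_conv_nth list_all2_conv_all_nth safe_def)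
  \<comment> \<open>Invariant: no cop can reach the robber in one move. The cops therefore miss him
    on their turn, and \<open>evade\<close> restores the invariant on his.\<close>
  have safe: "safe (cops_at \<sigma> r i) (r i)" for i
  proof (induction i)
    case 0
    show ?case using r0 by (simp add: cops_at_def)
  next
    case (Suc i)
    have eq: "\<sigma> (h i) = cops_at \<sigma> r (Suc i)"
      by (simp add: cops_at_def h_eq)
    have "\<exists>s. move G (last (h i)) s \<and> safe (\<sigma> (h i)) s"
      using evade[OF len[of "Suc i"] _ missed[OF Suc]] Suc
      by (auto simp: eq safe_def r_def[symmetric])
    from someI_ex[OF this] this show ?case
      by (simp add: r_Suc reply_def eq)
  qed
  have "\<not> captured \<sigma> r"
    using safe missed by (auto simp: captured_def safe_def move_def)
  with win[OF play] show False by blast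
qed

text \<open>Padding with a dummy \<open>z\<close> brings zero, one and two cops to the same form;
  below, \<open>z\<close> is the square \<open>(0, 0)\<close> off the board.\<close>

lemma subset_pair_if_length_le_2:
  assumes "length cs \<le> 2" "r \<notin> set cs" "z \<noteq> r"
  obtains c d where "set cs \<subseteq> {c, d}" "c \<noteq> r" "d \<noteq> r"
proof (cases cs)
  case Nil
  then show thesis using assms(3) that[of z z] by simp
next
  case (Cons c cs')
  show thesis
  proof (cases cs')
    case Nil
    then show thesis using assms(2) Cons that[of c c] by simp
  next
    case (Cons d cs'')
    then show thesis using assms(1,2) \<open>cs = c # cs'\<close> that[of c d] by auto
  qed
qed

text \<open>All \<open>k \<le> 2\<close> are treated at once, since minimality of 3 demands that
  each smaller number fails.\<close>

lemma not_cops_win_queen_graph: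
  assumes "7 \<le> n" "k \<le> 2"
  shows "\<not> cops_win (queen_graph n) k"
proof (rule not_cops_win_if_evadable)
  fix cs :: "(int \<times> int) list" and r
  assume cs: "length cs = k" and r: "r \<in> pverts (queen_graph n)" "r \<notin> set cs"
  have "(0, 0) \<noteq> r"
    using r(1) by auto
  then obtain c d where "set cs \<subseteq> {c, d}" "c \<noteq> r" "d \<noteq> r"
    using subset_pair_if_length_le_2 cs assms(2) r(2) by metis
  moreover from ex_safe_square[OF assms(1) r(1) this(2,3)] obtain s where
    "s \<in> pverts (queen_graph n)" "aligned r s" "\<not> aligned c s" "\<not> aligned d s"
    by blast
  ultimately show "\<exists>s \<in> pverts (queen_graph n). move (queen_graph n) r s \<and> (\<forall>c \<in> set cs. \<not> move (queen_graph n) c s)"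
    using move_queen_graph_iff[OF r(1)] move_queen_graph_imp_aligned by blast
next
  fix cs :: "(int \<times> int) list"
  assume cs: "length cs = k"
  \<comment> \<open>Of three squares, one is not occupied by the two cops.
    \<open>ex_safe_square\<close>, applied as if the robber stood there, then yields his actual
    starting square.\<close>
  have "\<not> (\<lambda>j. (j, 1)) ` {1, 2, 3} \<subseteq> set cs"
  proof
    assume "(\<lambda>j. (j, 1)) ` {1, 2, 3} \<subseteq> set cs"
    then have "card ((\<lambda>j. (j, 1 :: int)) ` {1, 2, 3 :: int}) \<le> card (set cs)"
      by (intro card_mono) auto
    also have "\<dots> \<le> 2"
      using card_length[of cs] cs assms(2) by simp
    finally show False
      by (simp add: card_image inj_on_def)
  qed
  then obtain r where "r \<in> (\<lambda>j. (j, 1)) ` {1, 2, 3}" and r': "r \<notin> set cs"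
    by blast
  with assms(1) have r: "r \<in> pverts (queen_graph n)" "r \<notin> set cs"
    by auto
  have "(0, 0) \<noteq> r"
    using r(1) by auto
  then obtain c d where "set cs \<subseteq> {c, d}" "c \<noteq> r" "d \<noteq> r"
    using subset_pair_if_length_le_2 cs assms(2) r(2) by metis
  moreover from ex_safe_square[OF assms(1) r(1) this(2,3)] obtain s where
    "s \<in> pverts (queen_graph n)" "\<not> aligned c s" "\<not> aligned d s"
    by blast
  ultimately show "\<exists>s \<in> pverts (queen_graph n). \<forall>c \<in> set cs. \<not> move (queen_graph n) c s"
    using move_queen_graph_imp_aligned by blast
qed

section \<open>Winning positions\<close>

text \<open>The robber is to move and \<open>k\<close> bounds his remaining turns. The bound makes
  this a recursion on a number, although the graph of positions has cycles.\<close>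

fun wins :: "'a pair_pre_digraph \<Rightarrow> nat \<Rightarrow> 'a list \<Rightarrow> 'a \<Rightarrow> bool" where
  "wins G 0 cs r \<longleftrightarrow> r \<in> set cs"
| "wins G (Suc k) cs r \<longleftrightarrow> r \<in> set cs \<or>
     (\<forall>s. move G r s \<longrightarrow> (\<exists>cs'. list_all2 (move G) cs cs' \<and> wins G k cs' s))"

text \<open>The \<open>i\<close>-th reply aims at a position won within \<open>k - i\<close> turns; a reply to an arbitrary winning
  position would not guarantee progress.\<close>

lemma cops_win_if_wins:
  assumes cs\<^sub>0: "length cs\<^sub>0 = m" "set cs\<^sub>0 \<subseteq> pverts G"
    and wins: "\<And>r. r \<in> pverts G \<Longrightarrow> \<exists>cs. list_all2 (move G) cs\<^sub>0 cs \<and> wins G k cs r"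
  shows "cops_win G m"
proof -
  define reply where "reply i cs r =
    (if \<exists>cs'. list_all2 (move G) cs cs' \<and> wins G (k - i) cs' r
     then SOME cs'. list_all2 (move G) cs cs' \<and> wins G (k - i) cs' r else cs)" for i cs r
  \<comment> \<open>A strategy sees the robber's squares only, so the cops' own earlier replies are
    recomputed by replaying the history.\<close>
  define \<sigma> where "\<sigma> h = fold (\<lambda>i cs. reply i cs (h ! i)) [0..<length h] cs\<^sub>0" for h
  have cops_0: "cops_at \<sigma> r 0 = cs\<^sub>0" for r
    by (simp add: cops_at_def \<sigma>_def)
  have cops_Suc: "cops_at \<sigma> r (Suc i) = reply i (cops_at \<sigma> r i) (r i)" for r i
  proof -
    have "fold (\<lambda>j cs. reply j cs (map r [0..<Suc i] ! j)) [0..<i] cs\<^sub>0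
        = fold (\<lambda>j cs. reply j cs (map r [0..<i] ! j)) [0..<i] cs\<^sub>0"
      by (intro fold_cong) (auto simp: nth_append simp del: upt_Suc)
    then show ?thesis
      by (simp add: cops_at_def \<sigma>_def nth_append)
  qed
  \<comment> \<open>The default of standing still keeps the strategy legal where no winning reply
    exists, as may happen after a capture.\<close>
  have step: "list_all2 (move G) cs (reply i cs r)" for i cs r
  proof (cases "\<exists>cs'. list_all2 (move G) cs cs' \<and> wins G (k - i) cs' r")
    case True
    from someI_ex[OF this] show ?thesis
      unfolding reply_def if_P[OF True] by simp
  next
    case False
    show ?thesis
      unfolding reply_def if_not_P[OF False] by (simp add: list.rel_refl move_def)
  qed
  have reply_wins: "wins G (k - i) (reply i cs r) r"
    if "\<exists>cs'. list_all2 (move G) cs cs' \<and> wins G (k - i) cs' r" for i cs r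
    unfolding reply_def if_P[OF that] using someI_ex[OF that] by simp
  have "cop_strategy G m \<sigma>"
    using cs\<^sub>0 step by (simp add: cop_strategy_def cops_Suc) (simp add: \<sigma>_def)
  moreover have "captured \<sigma> r" if r: "robber_play G r" for r
  proof (rule ccontr)
    assume free: "\<not> captured \<sigma> r"
    \<comment> \<open>As long as there is no capture, every turn goes through the second disjunct of
      \<open>wins\<close> and lowers the bound; at \<open>i = k\<close> the bound 0 itself means
      capture.\<close>
    have *: "i \<le> k \<Longrightarrow> wins G (k - i) (cops_at \<sigma> r (Suc i)) (r i)" for i
    proof (induction i)
      case 0
      have "r 0 \<in> pverts G"
        using r by (simp add: robber_play_def)
      then show ?case
        using reply_wins[of cs\<^sub>0 0 "r 0"] wins by (simp add: cops_Suc cops_0)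
    next
      case (Suc i)
      have "wins G (Suc (k - Suc i)) (cops_at \<sigma> r (Suc i)) (r i)"
        using Suc by (simp add: Suc_diff_Suc)
      moreover have "r i \<notin> set (cops_at \<sigma> r (Suc i))"
        using free by (auto simp: captured_def)
      moreover have "move G (r i) (r (Suc i))"
        using r by (simp add: robber_play_def)
      ultimately show ?case
        by (simp add: cops_Suc[of _ "Suc i"] reply_wins)
    qed
    from *[of k] free show False
      by (auto simp: captured_def)
  qed
  ultimately show ?thesis
    by (auto simp: cops_win_def)
qed

section \<open>Invariance of \<open>wins\<close> under larger bounds, reordering of the cops and
  symmetries\<close>

lemma wins_mono: "wins G k cs r \<Longrightarrow> k \<le> l \<Longrightarrow> wins G l cs r"
proof (induction G k cs r arbitrary: l rule: wins.induct)
  case (1 G cs r)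
  then show ?case by (cases l) auto
next
  case (2 G k cs r)
  then obtain l' where "l = Suc l'" "k \<le> l'"
    by (cases l) auto
  with 2 show ?case
    by (metis wins.simps(2))
qed

text \<open>Cops move independently of each other, so a reply can be carried along any reordering of
  them.\<close>

lemma wins_if_mset_eq: "wins G k cs r \<Longrightarrow> mset cs = mset ds \<Longrightarrow> wins G k ds r"
proof (induction G k cs r arbitrary: ds rule: wins.induct)
  case (1 G cs r)
  then show ?case by (auto dest: mset_eq_setD)
next
  case (2 G k cs r)
  have "\<exists>ds'. list_all2 (move G) ds ds' \<and> wins G k ds' s"
    if cs': "list_all2 (move G) cs cs'" "wins G k cs' s" and s: "move G r s" for s cs'
  proof -
    obtain ds' where "list_all2 (move G) ds ds'" "mset ds' = mset cs'"
      using list_all2_reorder_left_invariance[OF cs'(1) 2(3)[symmetric]] by auto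
    then show ?thesis
      using 2(1)[OF s cs'(2)] by auto
  qed
  then show ?case
    using 2(2) mset_eq_setD[OF 2(3)] by auto
qed

text \<open>Surjectivity on the whole type pulls every move of the robber from \<open>f r\<close>
  back to a move from \<open>r\<close>; the reply found there is mapped forward.\<close>

lemma wins_automorphism:
  assumes f: "surj f" "\<And>u v. move G (f u) (f v) \<longleftrightarrow> move G u v"
  shows "wins G k cs r \<Longrightarrow> wins G k (map f cs) (f r)"
proof (induction k arbitrary: cs r)
  case 0
  then show ?case by simp
next
  case (Suc k)
  have "\<exists>cs'. list_all2 (move G) (map f cs) cs' \<and> wins G k cs' s"
    if "f r \<notin> set (map f cs)" "move G (f r) s" for s
  proof -
    obtain s' where s': "s = f s'"
      using f(1) by blast
    with that f(2) Suc.prems obtain cs' where "list_all2 (move G) cs cs'" "wins G k cs' s'"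
      by auto
    then show ?thesis
      using Suc.IH f(2) by (intro exI[of _ "map f cs'"]) (simp add: s' list_all2_map1 list_all2_map2)
  qed
  then show ?case
    by auto
qed

text \<open>The dihedral group of the square, acting on the whole plane. Every code other than 0 to
  6 means the reflection in the antidiagonal, so the codes of a certificate need no
  validation.\<close>

definition reflect :: "int \<Rightarrow> int \<Rightarrow> int \<times> int \<Rightarrow> int \<times> int" where
  "reflect n g u = (case u of (x, y) \<Rightarrow>
     if g = 0 then (x, y) else if g = 1 then (y, x)
     else if g = 2 then (n + 1 - x, y) else if g = 3 then (x, n + 1 - y)
     else if g = 4 then (n + 1 - x, n + 1 - y) else if g = 5 then (n + 1 - y, x)
     else if g = 6 then (y, n + 1 - x) else (n + 1 - y, n + 1 - x))"

lemma reflect_cases: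
  obtains "\<And>x y. reflect n g (x, y) = (x, y)" | "\<And>x y. reflect n g (x, y) = (y, x)"
  | "\<And>x y. reflect n g (x, y) = (n + 1 - x, y)" | "\<And>x y. reflect n g (x, y) = (x, n + 1 - y)"
  | "\<And>x y. reflect n g (x, y) = (n + 1 - x, n + 1 - y)" | "\<And>x y. reflect n g (x, y) = (n + 1 - y, x)"
  | "\<And>x y. reflect n g (x, y) = (y, n + 1 - x)" | "\<And>x y. reflect n g (x, y) = (n + 1 - y, n + 1 - x)"
proof -
  consider "g = 0" | "g = 1" | "g = 2" | "g = 3" | "g = 4" | "g = 5" | "g = 6" | "g \<notin> {0, 1, 2, 3, 4, 5, 6}"
    by blast
  then show thesis
    by cases (simp_all add: reflect_def that)
qed

lemma surj_reflect: "surj (reflect n g)"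
proof -
  have "\<exists>v. reflect n g v = (x, y)" for x y
  proof (rule reflect_cases[of n g])
    \<comment> \<open>The first two cases are the quarter turns, inverse to each other; all others
      are involutions.\<close>
    assume *: "\<And>x y. reflect n g (x, y) = (n + 1 - y, x)"
    show ?thesis using *[of y "n + 1 - x"] by auto
  next
    assume *: "\<And>x y. reflect n g (x, y) = (y, n + 1 - x)"
    show ?thesis using *[of "n + 1 - y" x] by auto
  next
    assume *: "\<And>x y. reflect n g (x, y) = (n + 1 - x, y)"
    show ?thesis using *[of "n + 1 - x" y] by auto
  next
    assume *: "\<And>x y. reflect n g (x, y) = (x, n + 1 - y)"
    show ?thesis using *[of x "n + 1 - y"] by auto
  next
    assume *: "\<And>x y. reflect n g (x, y) = (n + 1 - x, n + 1 - y)"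
    show ?thesis using *[of "n + 1 - x" "n + 1 - y"] by auto
  next
    assume *: "\<And>x y. reflect n g (x, y) = (n + 1 - y, n + 1 - x)"
    show ?thesis using *[of "n + 1 - y" "n + 1 - x"] by auto
  qed blast+
  then show ?thesis
    by (metis surj_def surj_pair)
qed

lemma reflect_in_pverts_iff:
  "reflect (int n) g u \<in> pverts (queen_graph n) \<longleftrightarrow> u \<in> pverts (queen_graph n)"
  by (cases u; rule reflect_cases[of "int n" g]; auto)

lemma aligned_reflect_iff: "aligned (reflect n g u) (reflect n g v) \<longleftrightarrow> aligned u v"
  by (cases u; cases v; rule reflect_cases[of n g]; auto simp: aligned_def)

lemma reflect_eq_iff: "reflect n g u = reflect n g v \<longleftrightarrow> u = v"
  by (cases u; cases v; rule reflect_cases[of n g]; auto)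

lemma wins_reflect:
  assumes "wins (queen_graph n) k cs r"
  shows "wins (queen_graph n) k (map (reflect (int n) g) cs) (reflect (int n) g r)"
  using surj_reflect _ assms
  by (rule wins_automorphism)
    (simp add: move_def parcs_queen_graph_iff reflect_in_pverts_iff aligned_reflect_iff reflect_eq_iff
      del: pverts_queen_graph)

text \<open>A position is stored with one order of its cops, so a reply must also say which cop goes
  where. On three cops, every code other than 0 to 4 means reversal.\<close>

definition permute :: "int \<Rightarrow> 'a list \<Rightarrow> 'a list" where
  "permute p cs = (case cs of [a, b, c] \<Rightarrow>
     if p = 0 then [a, b, c] else if p = 1 then [a, c, b] else if p = 2 then [b, a, c]
     else if p = 3 then [b, c, a] else if p = 4 then [c, a, b] else [c, b, a] | _ \<Rightarrow> cs)"

lemma mset_permute [simp]: "mset (permute p cs) = mset cs"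
  by (auto simp: permute_def split: list.split)

section \<open>Unattacked squares within the robber's reach\<close>

definition free_squares :: "(int \<times> int) list \<Rightarrow> (int \<times> int) list \<Rightarrow> (int \<times> int) list" where
  "free_squares cs = filter (\<lambda>s. \<not> list_ex (\<lambda>c. aligned c s) cs)"

text \<open>A line of the robber on which a cop stands is attacked as a whole.\<close>

definition free_squares_on :: "(int \<times> int \<Rightarrow> bool) \<Rightarrow> (int \<times> int) list \<Rightarrow> (int \<times> int) list \<Rightarrow> (int \<times> int) list" where
  "free_squares_on l cs ss = (if list_ex l cs then [] else free_squares cs ss)"

text \<open>The order is part of the certificate format, because answers are matched by place. The
  robber's own square, his option to stay, is kept on the first line only, so that no square is
  listed twice. The bounds with \<open>max\<close> and \<open>min\<close> keep the second coordinate
  of a diagonal on the board.\<close>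

definition escapes :: "int \<Rightarrow> (int \<times> int) list \<Rightarrow> int \<times> int \<Rightarrow> (int \<times> int) list" where
  "escapes n cs r = (case r of (x, y) \<Rightarrow>
     free_squares_on (\<lambda>(a, b). a = x) cs (map (Pair x) [1..n]) @
     free_squares_on (\<lambda>(a, b). b = y) cs (map (\<lambda>i. (i, y)) ([1..x - 1] @ [x + 1..n])) @
     free_squares_on (\<lambda>(a, b). a + y = x + b) cs
       (map (\<lambda>i. (i, i + (y - x))) ([max 1 (1 + x - y)..x - 1] @ [x + 1..min n (n + x - y)])) @
     free_squares_on (\<lambda>(a, b). a + b = x + y) cs
       (map (\<lambda>i. (i, x + y - i)) ([max 1 (x + y - n)..x - 1] @ [x + 1..min n (x + y - 1)])))"

lemma in_escapes:
  assumes s_in: "s \<in> {1..n} \<times> {1..n}" and "aligned r s" and free: "\<And>c. c \<in> set cs \<Longrightarrow> \<not> aligned c s"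
  shows "s \<in> set (escapes n cs r)"
proof -
  obtain x y u v where r: "r = (x, y)" and s: "s = (u, v)"
    by (metis surj_pair)
  have on: "s \<in> set (free_squares_on l cs ss)" if "s \<in> set ss" "\<And>a b. l (a, b) \<Longrightarrow> aligned (a, b) s" for l ss
    using that free by (fastforce simp: free_squares_on_def free_squares_def list_ex_iff)
  consider "u = x" | "v = y" "u \<noteq> x" | "x + v = u + y" "u \<noteq> x" | "x + y = u + v" "u \<noteq> x"
    using assms(2) unfolding r s aligned_def by auto
  then show ?thesis
  proof cases
    case 1
    then have "s \<in> set (free_squares_on (\<lambda>(a, b). a = x) cs (map (Pair x) [1..n]))"
      using s_in by (intro on) (auto simp: s aligned_def)
    then show ?thesis
      by (simp add: escapes_def r)
  next
    case 2
    then have "s \<in> set (free_squares_on (\<lambda>(a, b). b = y) cs (map (\<lambda>i. (i, y)) ([1..x - 1] @ [x + 1..n])))"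
      using s_in by (intro on) (auto simp: s aligned_def image_iff)
    then show ?thesis
      by (simp add: escapes_def r)
  next
    case 3
    then have "s \<in> set (free_squares_on (\<lambda>(a, b). a + y = x + b) cs
       (map (\<lambda>i. (i, i + (y - x))) ([max 1 (1 + x - y)..x - 1] @ [x + 1..min n (n + x - y)])))"
      using s_in by (intro on) (auto simp: s aligned_def image_iff)
    then show ?thesis
      by (simp add: escapes_def r)
  next
    case 4
    then have "s \<in> set (free_squares_on (\<lambda>(a, b). a + b = x + y) cs
       (map (\<lambda>i. (i, x + y - i)) ([max 1 (x + y - n)..x - 1] @ [x + 1..min n (x + y - 1)])))"
      using s_in by (intro on) (auto simp: s aligned_def image_iff)
    then show ?thesis
      by (simp add: escapes_def r)
  qed
qed

text \<open>In \<open>E a a' b b' c c' x y ks\<close> the cops stand on \<open>(a, a')\<close>, \<open>(b, b')\<close>, \<open>(c, c')\<close>, and the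
  robber, on \<open>(x, y)\<close>, is to move. The triple \<open>(i, g, p)\<close> at some place in \<open>ks\<close> answers the escape at
  the same place in \<open>escapes\<close>: take the position found \<open>i + 1\<close> entries earlier, apply the symmetry
  \<open>g\<close> of the board to it, and permute the cops by \<open>p\<close>.\<close>

datatype entry = E int int int int int int int int "(int \<times> int \<times> int) list"

section \<open>The certificate check\<close>

type_synonym position = "(int \<times> int) list \<times> int \<times> int"

text \<open>Separates the look-up from \<open>drop\<close>, so that it can be evaluated on binary
  numerals.\<close>

definition skip :: "int \<Rightarrow> 'a list \<Rightarrow> 'a list" where
  "skip i = drop (nat i)"

text \<open>Testing \<open>aligned\<close> instead of \<open>move\<close> is enough, as all recorded
  positions are on the board and the symmetries preserve it. An index beyond the end of the list is
  rejected by the first equation.\<close>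

fun answered_by :: "int \<Rightarrow> (int \<times> int) list \<Rightarrow> int \<times> int \<Rightarrow> int \<Rightarrow> int \<Rightarrow> position list \<Rightarrow> bool" where
  "answered_by n cs s g p [] \<longleftrightarrow> False"
| "answered_by n cs s g p ((ds, r) # _) \<longleftrightarrow>
     reflect n g r = s \<and> list_all2 aligned cs (permute p (map (reflect n g) ds))"

fun answers :: "int \<Rightarrow> position list \<Rightarrow> (int \<times> int) list \<Rightarrow> (int \<times> int) list \<Rightarrow> (int \<times> int \<times> int) list \<Rightarrow> bool" where
  "answers n won cs [] [] \<longleftrightarrow> True"
| "answers n won cs (s # ss) ((i, g, p) # ks) \<longleftrightarrow> answered_by n cs s g p (skip i won) \<and> answers n won cs ss ks"
| "answers n won cs _ _ \<longleftrightarrow> False"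

definition on_board :: "int \<Rightarrow> int \<times> int \<Rightarrow> bool" where
  "on_board n u \<longleftrightarrow> 1 \<le> fst u \<and> fst u \<le> n \<and> 1 \<le> snd u \<and> snd u \<le> n"

text \<open>The latest entry stands in front of \<open>won\<close>, so indices count backwards and
  reach checked entries only. After the last entry, \<open>cs\<close> and \<open>ks\<close> come
  into play: the robber's choice of a starting square is answered like an escape to any unattacked
  square of the board.\<close>

fun certify :: "int \<Rightarrow> position list \<Rightarrow> (int \<times> int) list \<Rightarrow> (int \<times> int \<times> int) list \<Rightarrow> entry list \<Rightarrow> bool" where
  "certify n won cs ks [] \<longleftrightarrow>
     list_all (on_board n) cs \<and> answers n won cs (free_squares cs (List.product [1..n] [1..n])) ks"
| "certify n won cs ks (E a a' b b' c c' x y ls # es) \<longleftrightarrow>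
     list_all (on_board n) [(a, a'), (b, b'), (c, c'), (x, y)] \<and>
     answers n won [(a, a'), (b, b'), (c, c')] (escapes n [(a, a'), (b, b'), (c, c')] (x, y)) ls \<and>
     certify n (([(a, a'), (b, b'), (c, c')], (x, y)) # won) cs ks es"

definition won_in :: "nat \<Rightarrow> nat \<Rightarrow> position \<Rightarrow> bool" where
  "won_in n k q \<longleftrightarrow> set (fst q) \<subseteq> pverts (queen_graph n) \<and> snd q \<in> pverts (queen_graph n) \<and>
     wins (queen_graph n) k (fst q) (snd q)"

lemma wins_if_caught: "r \<in> set cs \<Longrightarrow> wins G k cs r"
  by (cases k) auto

lemma on_board_iff [simp]: "on_board (int n) u \<longleftrightarrow> u \<in> pverts (queen_graph n)"
  by (cases u) (auto simp: on_board_def)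

text \<open>The reason why attacked squares need no answer in a certificate: one cop captures while
  the others stay.\<close>

lemma ex_capture:
  assumes "c \<in> set cs" "move G c s"
  shows "\<exists>cs'. list_all2 (move G) cs cs' \<and> wins G k cs' s"
proof -
  obtain as bs where "cs = as @ c # bs"
    using assms(1) by (auto dest: split_list)
  then have "list_all2 (move G) cs (as @ s # bs)"
    using assms(2) by (auto intro!: list_all2_appendI list.rel_refl simp: move_def)
  moreover have "wins G k (as @ s # bs) s"
    by (rule wins_if_caught) simp
  ultimately show ?thesis by blast
qed

lemma answers_imp_wins:
  assumes "answers (int n) won cs ss ks" "\<forall>q \<in> set won. won_in n k q"
    "set cs \<subseteq> pverts (queen_graph n)" "s \<in> set ss"
  shows "\<exists>cs'. list_all2 (move (queen_graph n)) cs cs' \<and> wins (queen_graph n) k cs' s"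
  using assms
proof (induction "int n" won cs ss ks rule: answers.induct)
  case (2 won cs t ss i g p ks)
  show ?case
  proof (cases "s = t")
    case True
    obtain ds r rest where "skip i won = (ds, r) # rest" and r: "reflect (int n) g r = s"
      and al: "list_all2 aligned cs (permute p (map (reflect (int n) g) ds))"
      using 2(2) True by (auto elim: answered_by.elims)
    then have "(ds, r) \<in> set won"
      by (metis skip_def in_set_dropD list.set_intros(1))
    then have ds: "set ds \<subseteq> pverts (queen_graph n)" and won: "wins (queen_graph n) k ds r"
      using bspec[OF 2(3)] unfolding won_in_def by (metis fst_conv, metis fst_conv snd_conv)
    let ?cs = "permute p (map (reflect (int n) g) ds)"
    have "wins (queen_graph n) k ?cs s"
      using wins_reflect[OF won, of g] r by (auto intro: wins_if_mset_eq)
    moreover have "set ?cs = set (map (reflect (int n) g) ds)"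
      by (rule mset_eq_setD) simp
    then have "set ?cs \<subseteq> pverts (queen_graph n)"
      using ds by (auto simp: reflect_in_pverts_iff simp del: pverts_queen_graph)
    then have "list_all2 (move (queen_graph n)) cs ?cs"
      using al 2(4) by (auto elim!: list.rel_mono_strong simp: move_queen_graph_iff subset_iff simp del: pverts_queen_graph)
    ultimately show ?thesis
      by blast
  next
    case False
    then show ?thesis using 2 by auto
  qed
qed auto

text \<open>Invariant: every position in \<open>won\<close> is won within \<open>length won\<close>
  turns of the robber. From a new entry each of his moves leads either to an attacked square or to
  an escape whose answer is in \<open>won\<close>, so one turn more suffices, and
  \<open>wins_mono\<close> lifts the older positions to the new bound.\<close>

lemma cops_win_if_certify:
  assumes "certify (int n) won cs ks es" "\<forall>q \<in> set won. won_in n (length won) q"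
  shows "cops_win (queen_graph n) (length cs)"
  using assms
proof (induction "int n" won cs ks es rule: certify.induct)
  case (1 won cs ks)
  have cs: "set cs \<subseteq> pverts (queen_graph n)"
    and answers: "answers (int n) won cs (free_squares cs (List.product [1..int n] [1..int n])) ks"
    using 1(1) by (auto simp: list_all_iff simp del: pverts_queen_graph)
  show ?case
  proof (rule cops_win_if_wins[OF refl cs])
    fix r
    assume r: "r \<in> pverts (queen_graph n)"
    show "\<exists>cs'. list_all2 (move (queen_graph n)) cs cs' \<and> wins (queen_graph n) (length won) cs' r"
    proof (cases "\<exists>u \<in> set cs. aligned u r")
      case True
      then obtain u where "u \<in> set cs" "move (queen_graph n) u r"
        using r cs move_queen_graph_iff by blast
      then show ?thesis
        by (rule ex_capture)
    next
      case False
      then have "r \<in> set (free_squares cs (List.product [1..int n] [1..int n]))"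
        using r by (auto simp: free_squares_def list_ex_iff)
      then show ?thesis
        using answers_imp_wins[OF answers 1(2) cs] by blast
    qed
  qed
next
  case (2 won cs ks a a' b b' c c' x y ls es)
  let ?cs = "[(a, a'), (b, b'), (c, c')]" and ?r = "(x, y)"
  have board: "set ?cs \<subseteq> pverts (queen_graph n)" "?r \<in> pverts (queen_graph n)"
    and answers: "answers (int n) won ?cs (escapes (int n) ?cs ?r) ls"
    and rest: "certify (int n) ((?cs, ?r) # won) cs ks es"
    using 2(2) by (auto simp del: answers.simps)
  have "\<exists>cs'. list_all2 (move (queen_graph n)) ?cs cs' \<and> wins (queen_graph n) (length won) cs' s"
    if "move (queen_graph n) ?r s" for s
  proof -
    have s: "s \<in> pverts (queen_graph n)" "aligned ?r s"
      using that move_queen_graph_iff[OF board(2)] by auto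
    show ?thesis
    proof (cases "\<exists>u \<in> set ?cs. aligned u s")
      case True
      then obtain u where "u \<in> set ?cs" "move (queen_graph n) u s"
        using s(1) board(1) move_queen_graph_iff by blast
      then show ?thesis
        by (rule ex_capture)
    next
      case False
      then have "s \<in> set (escapes (int n) ?cs ?r)"
        using s by (intro in_escapes) auto
      then show ?thesis
        using answers_imp_wins[OF answers 2(3) board(1)] by blast
    qed
  qed
  then have "won_in n (Suc (length won)) (?cs, ?r)"
    using board by (simp add: won_in_def)
  moreover have "won_in n (Suc (length won)) q" if "q \<in> set won" for q
    using 2(3) that by (auto simp: won_in_def simp del: wins.simps intro: wins_mono)
  ultimately show ?case
    by (intro 2(1) rest) auto
qed

text \<open>The innermost test of the check, stated on coordinates, with the four line equations
  tried one after the other.\<close>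

lemma aligned_code [code]:
  "aligned (a, b) (x, y) =
     (if a = x then True else if b = y then True else if a + b = x + y then True else a + y = x + b)"
  by (simp add: aligned_def)

text \<open>The default code equations would expand the index in unary.\<close>

lemma skip_code [code]:
  "skip 0 xs = xs"
  "skip (Int.Neg k) xs = xs"
  "skip (Int.Pos num.One) xs = tl xs"
  "skip (Int.Pos (num.Bit0 k)) xs = skip (Int.Pos k) (skip (Int.Pos k) xs)"
  "skip (Int.Pos (num.Bit1 k)) xs = skip (Int.Pos k) (skip (Int.Pos k) (tl xs))"
proof -
  have "nat (Int.Pos (num.Bit0 k)) = nat (Int.Pos k) + nat (Int.Pos k)"
    "nat (Int.Pos (num.Bit1 k)) = Suc (nat (Int.Pos k) + nat (Int.Pos k))"
    by (simp_all only: Int.Pos_def numeral_Bit0 numeral_Bit1) (simp_all add: nat_add_distrib)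
  then show
    "skip (Int.Pos (num.Bit0 k)) xs = skip (Int.Pos k) (skip (Int.Pos k) xs)"
    "skip (Int.Pos (num.Bit1 k)) xs = skip (Int.Pos k) (skip (Int.Pos k) (tl xs))"
    by (simp_all only: skip_def drop_drop drop_Suc)
qed (simp_all add: skip_def drop_Suc)

section \<open>Strategies\<close>

text \<open>Only four squares escape the initial cops. They are images of each other under
  symmetries of the board, and a single dead end answers them all.\<close>

lemma cops_win_7: "cops_win (queen_graph 7) 3"
proof -
  have "certify (int 7) [] [(2,2),(4,4),(6,6)]
    [(0,3,0),(0,6,5),(0,5,0),(0,2,5)]
    [E 1 7 2 6 5 3 1 3 []]"
    by code_simp
  from cops_win_if_certify[OF this] show ?thesis
    by (simp add: numeral_3_eq_3)
qed

lemma cops_win_8: "cops_win (queen_graph 8) 3"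
proof -
  have "certify (int 8) [] [(3,3),(4,5),(5,4)]
    [(2,3,0),(1,3,0),(0,3,0),(1,6,0),(2,5,1),(0,5,1),(2,7,2),(1,5,1),(1,2,1),(2,4,3)]
    [E 1 8 2 6 5 3 1 3 [],
    E 1 8 2 2 4 5 1 2 [],
    E 2 5 3 3 4 5 2 3 []]"
    by code_simp
  from cops_win_if_certify[OF this] show ?thesis
    by (simp add: numeral_3_eq_3)
qed

lemma cops_win_9: "cops_win (queen_graph 9) 3"
proof -
  have "certify (int 9) [] [(4,5),(5,5),(6,5)]
    [(3,0,0),(2,0,0),(2,3,0),(3,3,0),(1,0,2),(1,3,2),(0,1,2),(0,6,2),(0,5,4),(0,7,4),(1,2,4),
     (1,4,4),(0,2,2),(2,2,5),(2,4,5),(0,4,2)]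
    [E 1 2 3 3 3 5 1 3 [],
    E 1 2 2 5 7 4 1 4 [],
    E 2 2 3 5 5 4 2 4 [],
    E 1 1 4 3 4 6 1 3 []]"
    by code_simp
  from cops_win_if_certify[OF this] show ?thesis
    by (simp add: numeral_3_eq_3)
qed

lemma cops_win_10: "cops_win (queen_graph 10) 3"
proof -
  have "certify (int 10) [] [(5,5),(6,6),(7,4)]
    [(8,0,0),(7,0,1),(6,3,0),(5,3,1),(4,1,0),(3,0,1),(2,3,4),(5,1,5),(1,1,0),(5,6,4),(2,1,3),
     (0,1,2),(2,6,1),(6,6,2),(5,5,1),(0,4,5),(3,7,4),(5,7,3),(2,4,5),(1,4,3),(8,7,2),(5,2,4),
     (5,4,3),(4,4,2)]
    [E 1 1 2 2 3 4 1 2 [],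
    E 1 1 2 4 3 3 1 3 [],
    E 1 2 2 5 4 4 1 4 [],
    E 1 10 3 3 3 5 1 3 [],
    E 1 1 2 2 4 5 1 2 [],
    E 2 2 3 4 6 3 2 3 [],
    E 2 5 4 4 5 7 2 4 [],
    E 2 5 3 3 4 5 2 3 [],
    E 3 6 5 4 6 7 3 4 []]"
    by code_simp
  from cops_win_if_certify[OF this] show ?thesis
    by (simp add: numeral_3_eq_3)
qed

text \<open>On the smaller boards all entries are dead ends. Here one entry has an escape, answered
  by a mirror image of the entry just before it, so a capture may take one more turn.\<close>

lemma cops_win_11: "cops_win (queen_graph 11) 3"
proof -
  have "certify (int 11) [] [(5,6),(6,6),(7,6)]
    [(8,0,0),(7,0,0),(6,0,1),(6,3,1),(7,3,0),(8,3,0),(5,0,5),(4,0,2),(4,3,2),(5,3,5),(3,1,2),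
     (1,0,3),(1,3,3),(3,6,2),(7,1,5),(0,1,0),(0,6,0),(7,6,5),(7,5,0),(0,5,5),(0,7,5),(7,7,0),
     (3,5,4),(1,2,1),(1,4,1),(3,7,4),(5,2,0),(4,2,4),(4,4,4),(5,4,0),(3,2,2),(7,2,5),(6,2,3),
     (6,4,3),(7,4,5),(8,4,5)]
    [E 1 2 3 3 4 6 1 3 [],
    E 1 2 3 6 7 4 1 4 [],
    E 1 2 2 6 5 5 1 5 [],
    E 2 6 4 4 5 7 2 4 [],
    E 2 2 3 6 6 5 2 5 [],
    E 1 1 4 3 5 7 1 3 [],
    E 1 1 3 5 4 8 1 5 [],
    E 3 2 4 6 7 5 3 5 [(0,3,3)],
    E 2 5 4 4 5 7 2 4 []]"
    by code_simp
  from cops_win_if_certify[OF this] show ?thesis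
    by (simp add: numeral_3_eq_3)
qed

lemma cops_win_12: "cops_win (queen_graph 12) 3"
proof -
  have "certify (int 12) [] [(6,6),(7,7),(8,5)]
    [(18,0,0),(17,0,0),(15,0,1),(14,3,0),(13,3,0),(12,3,1),(11,1,0),(10,0,0),(9,0,3),(8,3,5),
     (7,3,4),(12,1,5),(6,1,3),(5,0,0),(3,3,1),(12,6,4),(9,1,3),(5,1,3),(7,6,1),(13,6,2),(2,1,4),
     (3,1,4),(0,1,2),(3,6,4),(8,6,3),(14,6,2),(13,5,0),(7,5,4),(0,4,5),(5,7,2),(9,7,5),(15,7,4),
     (12,5,1),(3,4,1),(5,4,5),(6,7,5),(12,7,3),(7,2,1),(9,4,5),(6,4,5),(18,7,2),(12,2,4),(13,2,2),
     (2,4,1),(12,4,3),(11,4,2)]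
    [E 1 1 2 2 4 5 1 2 [],
    E 1 1 3 3 3 5 1 3 [],
    E 1 2 2 1 3 3 2 3 [],
    E 1 1 2 5 4 4 1 4 [(0,1,2)],
    E 1 2 2 6 5 5 1 5 [],
    E 1 2 3 6 4 4 1 4 [],
    E 1 12 3 3 4 6 1 3 [],
    E 1 1 2 2 5 6 1 2 [],
    E 2 2 3 3 4 5 2 3 [(4,0,1)],
    E 2 5 4 4 5 7 2 4 [],
    E 2 2 3 6 6 5 2 5 [],
    E 2 6 4 4 5 7 2 4 [],
    E 2 5 3 3 6 7 2 3 [(6,1,1)],
    E 3 6 4 4 6 7 3 4 [(2,1,4)],
    E 4 6 6 4 7 7 4 4 [],
    E 3 7 6 8 7 5 3 5 [(0,0,0)],
    E 1 1 2 5 4 8 1 5 [],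
    E 1 3 5 9 7 5 1 5 [],
    E 4 7 6 5 7 8 4 5 [(0,5,2)]]"
    by code_simp
  from cops_win_if_certify[OF this] show ?thesis
    by (simp add: numeral_3_eq_3)
qed

text \<open>The cops start on the centre and its two neighbours on a diagonal. This placement has
  four symmetries, the codes 0, 1, 4 and 7, and accordingly index 22 answers four starting squares
  with just these codes.\<close>

lemma cops_win_13: "cops_win (queen_graph 13) 3"
proof -
  have "certify (int 13) [] [(6,6),(7,7),(8,8)]
    [(22,0,0),(21,0,0),(19,0,2),(18,0,3),(17,3,0),(16,3,1),(15,3,0),(22,1,0),(13,0,2),(12,0,1),
     (10,0,4),(9,3,4),(7,3,0),(15,6,5),(21,1,0),(13,1,2),(6,0,1),(4,0,4),(6,3,5),(7,6,5),(19,1,2),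
     (12,1,1),(6,1,1),(1,0,2),(0,3,2),(6,6,0),(16,6,3),(18,1,3),(10,1,4),(4,1,4),(1,1,2),(0,6,4),
     (9,6,2),(17,6,5),(17,5,0),(9,5,4),(0,5,2),(1,7,4),(4,7,2),(10,7,2),(18,7,1),(16,5,1),(6,5,5),
     (0,2,4),(1,4,4),(6,7,3),(12,7,3),(19,7,4),(7,5,0),(6,2,0),(4,4,2),(6,4,3),(13,7,4),(21,7,5),
     (15,5,0),(7,2,5),(9,2,2),(10,4,2),(12,4,3),(13,4,4),(22,7,5),(15,2,5),(16,2,3),(17,2,5),
     (18,4,1),(19,4,4),(21,4,5),(22,4,5)]
    [E 1 1 2 2 7 8 1 2 [],
    E 1 1 3 3 6 8 1 3 [],
    E 1 2 2 5 4 3 2 3 [],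
    E 1 1 3 6 4 4 1 4 [(0,0,0)],
    E 1 1 2 6 7 5 1 5 [],
    E 1 3 5 9 7 5 1 5 [],
    E 1 3 3 6 4 4 1 4 [],
    E 1 13 2 2 5 6 1 2 [],
    E 1 1 3 4 3 6 1 4 [],
    E 2 2 6 3 7 8 2 3 [(0,0,1)],
    E 2 6 4 4 5 7 2 4 [],
    E 3 6 5 4 6 7 3 4 [],
    E 2 7 5 8 6 5 2 5 [(0,0,0)],
    E 2 2 3 6 6 5 2 5 [],
    E 1 1 2 5 5 4 1 4 [],
    E 1 3 2 2 5 6 2 3 [(0,1,0)],
    E 3 6 4 4 6 7 3 4 [(2,1,4)],
    E 4 6 6 4 7 7 4 4 [],
    E 3 7 6 8 7 5 3 5 [(0,0,0)],
    E 2 1 3 6 8 5 2 5 [],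
    E 1 4 6 11 7 6 1 6 [(0,1,0)],
    E 4 7 6 5 7 8 4 5 [(0,5,2)],
    E 4 7 7 8 8 5 4 5 [(0,1,2)]]"
    by code_simp
  from cops_win_if_certify[OF this] show ?thesis
    by (simp add: numeral_3_eq_3)
qed

lemma cops_win_14: "cops_win (queen_graph 14) 3"
proof -
  have "certify (int 14) [] [(7,7),(8,9),(9,8)]
    [(50,0,0),(49,0,0),(47,0,0),(45,0,2),(43,3,0),(42,3,1),(41,3,0),(40,6,4),(38,0,1),(36,0,1),
     (32,0,3),(31,3,3),(29,3,1),(28,3,0),(27,6,2),(50,1,1),(24,0,0),(19,0,5),(25,3,3),(18,6,2),
     (17,6,2),(49,1,1),(38,1,0),(13,0,3),(26,3,4),(12,6,3),(10,6,2),(47,1,1),(36,1,0),(24,1,1),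
     (14,3,3),(22,6,0),(36,6,0),(8,6,4),(45,1,3),(32,1,2),(19,1,4),(13,1,4),(5,6,2),(19,6,4),
     (6,6,0),(3,6,5),(43,5,1),(31,5,2),(24,5,2),(14,2,5),(5,2,5),(25,7,2),(37,7,1),(2,7,4),
     (42,5,0),(29,5,0),(26,2,4),(22,2,1),(1,7,3),(49,7,0),(41,5,1),(18,2,3),(12,2,2),(19,2,5),
     (25,4,3),(0,7,2),(28,5,1),(17,2,3),(36,2,1),(6,2,1),(37,4,0),(1,4,2),(40,2,5),(27,2,3),
     (10,2,3),(8,2,5),(3,2,4),(2,4,5),(49,4,1),(0,4,3)]
    [E 1 1 2 3 6 8 1 3 [],
    E 1 1 3 4 5 8 1 4 [],
    E 2 1 3 5 4 4 2 4 [],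
    E 1 1 4 5 4 8 1 5 [(0,0,0)],
    E 3 6 5 4 6 7 3 4 [],
    E 1 2 2 7 11 6 1 6 [(0,1,2)],
    E 1 1 3 5 5 3 3 3 [],
    E 1 2 2 6 9 5 1 5 [(0,0,1)],
    E 1 2 4 7 6 4 1 4 [],
    E 1 2 4 6 5 3 1 3 [],
    E 1 3 7 7 14 1 1 1 [],
    E 1 2 3 5 5 9 1 5 [],
    E 2 2 5 4 7 9 2 4 [(0,0,1)],
    E 2 2 3 6 6 5 2 5 [],
    E 2 7 6 5 6 9 2 5 [(9,0,0),(0,1,1)],
    E 1 1 4 6 6 4 4 4 [],
    E 1 5 3 1 6 8 3 5 [(0,0,1)],
    E 1 5 2 2 7 6 2 6 [(0,1,0)],
    E 2 1 3 7 5 6 2 6 [(2,0,1),(0,1,3)],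
    E 2 7 6 9 8 5 2 5 [(14,0,2),(14,1,2)],
    E 1 3 4 8 5 5 1 5 [],
    E 2 3 5 7 6 4 2 4 [(0,0,0)],
    E 2 3 4 2 7 7 2 2 [],
    E 1 3 3 2 7 8 1 2 [],
    E 4 6 6 4 7 7 4 4 [],
    E 3 7 6 8 7 5 3 5 [(0,0,0)],
    E 3 7 7 9 9 5 3 5 [(1,0,2),(0,1,4)],
    E 1 1 3 7 5 11 1 7 [(9,1,3)],
    E 4 7 6 5 7 8 4 5 [(0,5,5)],
    E 1 5 2 2 12 6 2 6 [(12,1,0)],
    E 1 3 6 12 7 7 1 7 [(0,0,1)],
    E 3 8 6 9 7 6 3 6 [(2,0,0),(0,5,3)],
    E 1 3 3 2 7 7 3 3 [(20,1,2)],
    E 1 3 2 1 7 8 2 3 [],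
    E 2 1 3 6 8 5 2 5 [],
    E 1 4 6 11 7 6 1 6 [(0,1,0)],
    E 5 7 7 5 8 8 5 5 [(0,3,0),(0,5,2)],
    E 4 8 7 9 8 6 4 6 [(0,0,0),(1,5,0)],
    E 2 4 3 2 6 7 3 4 [(2,0,1)],
    E 1 1 3 4 3 6 1 4 [],
    E 1 3 5 4 6 9 1 4 [(0,1,0)],
    E 2 2 3 5 5 4 2 4 [],
    E 1 3 5 9 10 5 1 5 [(0,1,0)],
    E 1 3 5 9 7 5 1 5 [],
    E 2 7 6 6 7 11 2 6 [(18,0,0),(18,1,5)],
    E 5 8 7 6 8 9 5 6 [(1,3,0),(0,5,5),(1,5,0)],
    E 1 1 4 9 5 6 1 6 [(11,0,1)],
    E 1 3 3 8 9 6 1 6 [(33,0,1),(0,1,1)],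
    E 1 2 2 6 5 5 1 5 [],
    E 2 6 4 4 5 7 2 4 [],
    E 1 12 3 3 7 9 1 3 []]"
    by code_simp
  from cops_win_if_certify[OF this] show ?thesis
    by (simp add: numeral_3_eq_3)
qed

lemma cops_win_15: "cops_win (queen_graph 15) 3"
proof -
  have "certify (int 15) [] [(7,7),(8,9),(9,8)]
    [(72,0,0),(71,0,0),(69,0,0),(67,0,2),(64,3,0),(62,3,0),(61,3,0),(60,3,0),(59,6,4),(57,0,1),
     (56,0,1),(52,0,3),(49,3,3),(56,3,4),(48,3,0),(47,6,2),(72,1,1),(46,0,0),(35,0,0),(35,3,2),
     (33,3,1),(32,3,0),(31,6,2),(71,1,1),(57,1,0),(28,0,3),(22,3,4),(21,3,3),(20,6,3),(19,6,2),
     (69,1,1),(56,1,0),(46,1,1),(11,3,3),(29,3,2),(9,6,0),(8,6,0),(6,6,4),(67,1,3),(49,1,4),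
     (35,1,1),(28,1,4),(5,3,0),(28,6,4),(35,6,1),(4,6,0),(67,6,2),(64,5,1),(49,5,2),(35,5,3),
     (11,5,4),(5,2,5),(28,7,2),(35,7,3),(49,7,2),(3,7,4),(62,5,1),(56,5,5),(22,5,5),(29,2,1),
     (9,7,5),(8,7,5),(2,7,4),(61,5,1),(33,5,0),(21,2,3),(28,2,5),(28,4,3),(57,7,1),(1,7,0),
     (48,5,1),(32,5,1),(9,2,1),(35,2,0),(35,4,2),(46,4,4),(0,7,2),(60,5,1),(47,2,3),(20,2,2),
     (8,2,1),(4,2,1),(10,4,2),(8,4,4),(57,4,0),(59,2,5),(31,2,3),(19,2,3),(6,2,5),(67,2,3),(3,4,5),
     (2,4,5),(1,4,1),(0,4,3)]
    [E 1 1 2 3 6 8 1 3 [],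
    E 1 1 3 4 5 8 1 4 [],
    E 2 1 3 5 4 4 2 4 [],
    E 1 1 4 5 4 8 1 5 [(0,0,0)],
    E 3 6 5 4 6 7 3 4 [],
    E 1 2 2 7 11 6 1 6 [(0,1,2)],
    E 1 2 3 6 9 4 3 4 [(1,1,2)],
    E 2 2 3 6 6 5 2 5 [],
    E 1 3 2 7 11 6 1 6 [(1,0,0),(0,1,0)],
    E 1 3 2 2 5 4 2 4 [],
    E 1 3 3 7 9 5 1 5 [(0,1,2)],
    E 1 3 4 7 5 4 1 4 [],
    E 1 15 3 2 7 8 1 2 [],
    E 1 2 8 8 15 1 1 1 [],
    E 1 2 3 5 5 9 1 5 [],
    E 2 2 5 4 7 9 2 4 [(0,0,1)],
    E 2 7 6 5 6 9 2 5 [(11,0,0),(8,1,1)],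
    E 1 1 4 6 6 4 4 4 [],
    E 1 5 3 1 6 8 3 5 [(0,0,1)],
    E 1 5 2 2 7 6 2 6 [(0,1,0)],
    E 2 1 3 7 5 6 2 6 [(2,0,1),(0,1,3)],
    E 4 6 6 4 7 7 4 4 [],
    E 3 7 6 8 7 5 3 5 [(0,0,0)],
    E 2 8 5 9 7 6 2 6 [(0,0,0),(1,0,3),(3,1,2)],
    E 1 3 2 1 7 8 2 3 [],
    E 2 3 4 2 8 8 2 2 [],
    E 3 7 7 9 9 5 3 5 [(4,0,2),(3,1,4)],
    E 1 1 3 5 5 3 1 3 [],
    E 1 2 5 7 6 3 1 3 [(0,1,1)],
    E 2 2 3 6 7 3 3 3 [(18,0,0)],
    E 1 5 2 2 12 6 2 6 [(11,1,0)],
    E 1 3 6 12 7 7 1 7 [(0,0,1)],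
    E 2 2 3 7 5 6 2 6 [(0,1,1)],
    E 2 4 3 7 7 5 3 5 [(0,1,0)],
    E 2 2 3 7 7 3 3 3 [],
    E 1 2 2 1 14 3 2 3 [],
    E 1 2 5 7 10 3 1 3 [(8,1,1)],
    E 2 7 6 9 7 6 3 6 [(8,1,1),(7,0,0),(32,0,1),(14,0,0),(3,3,0),(2,3,0),(1,6,0),(0,6,1)],
    E 1 3 3 6 6 11 1 6 [(30,1,1)],
    E 2 4 3 2 6 7 3 4 [(0,0,0)],
    E 1 3 3 2 8 8 3 3 [(36,1,0)],
    E 1 2 5 3 7 9 1 3 [],
    E 1 5 5 11 7 7 1 7 [(11,1,1)],
    E 5 7 7 5 8 8 5 5 [(0,3,0),(0,5,2)],
    E 4 8 7 9 8 6 4 6 [(0,0,0),(12,5,3)],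
    E 1 2 5 5 6 1 1 1 [],
    E 1 6 2 2 5 6 1 2 [],
    E 1 6 2 4 5 3 1 3 [],
    E 1 6 2 6 5 5 1 5 [(45,1,1)],
    E 2 7 2 9 5 8 1 8 [(3,1,4),(2,0,0),(1,0,0),(0,0,0),(0,3,2),(1,3,2),(2,3,2),(3,6,1)],
    E 4 7 6 5 7 8 4 5 [(0,1,3)],
    E 4 8 7 7 8 4 4 4 [(28,0,0),(17,1,1)],
    E 2 3 6 4 6 8 2 4 [(41,0,0),(37,1,0)],
    E 1 2 4 7 13 4 1 4 [],
    E 2 1 3 6 8 5 2 5 [],
    E 1 4 6 11 7 6 1 6 [(0,1,0)],
    E 1 1 2 3 7 2 2 2 [],
    E 1 3 2 1 6 4 2 4 [],
    E 1 5 2 1 6 6 2 6 [(39,1,2)],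
    E 1 2 2 1 8 8 2 2 [],
    E 1 8 6 11 8 7 2 7 [(3,1,1),(24,0,1),(2,0,1),(43,0,0),(1,0,1),(36,3,1),(7,3,5),(0,3,0)],
    E 5 8 7 6 8 9 5 6 [(5,3,0),(0,5,3),(5,5,2)],
    E 2 7 6 6 7 11 2 6 [(28,0,1),(39,1,5)],
    E 3 7 7 5 7 9 3 5 [(41,0,0),(0,1,5)],
    E 2 7 4 5 6 9 2 5 [(56,1,1)],
    E 1 1 3 5 5 3 3 3 [],
    E 1 2 5 9 11 5 1 5 [(50,0,0),(0,0,1)],
    E 6 8 8 6 9 9 6 6 [(56,3,4),(4,3,3),(4,5,5),(56,5,1)],
    E 2 7 7 11 8 6 2 6 [(34,0,0),(16,0,2),(5,1,1)],
    E 1 2 2 7 6 6 1 6 [(62,1,1)],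
    E 1 2 3 7 9 5 1 5 [(17,0,0)],
    E 1 9 3 4 4 7 1 4 [],
    E 1 14 3 3 8 10 1 3 []]"
    by code_simp
  from cops_win_if_certify[OF this] show ?thesis
    by (simp add: numeral_3_eq_3)
qed

lemma cops_win_16: "cops_win (queen_graph 16) 3"
proof -
  have "certify (int 16) [] [(7,8),(8,7),(9,9)]
    [(190,0,1),(189,0,1),(187,0,0),(185,0,0),(179,3,1),(176,3,4),(174,3,0),(172,3,1),(171,3,1),
     (170,6,5),(169,0,1),(168,0,2),(165,0,5),(155,3,3),(153,3,2),(152,3,4),(151,3,1),(150,6,3),
     (190,1,4),(148,0,2),(134,0,1),(111,3,4),(97,3,3),(95,3,1),(94,3,1),(93,6,3),(189,1,4),
     (169,1,4),(86,0,1),(66,3,0),(56,3,4),(55,3,3),(54,6,3),(53,6,3),(187,1,2),(168,1,0),(148,1,0),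
     (76,3,3),(52,3,2),(51,6,4),(49,6,3),(48,6,5),(185,1,2),(72,1,4),(134,1,4),(86,1,4),(46,3,0),
     (40,3,0),(86,6,4),(34,6,1),(33,6,0),(32,6,3),(179,5,4),(155,5,5),(111,5,1),(66,5,2),(46,5,4),
     (28,7,4),(66,7,2),(22,7,5),(41,7,3),(19,7,5),(176,5,1),(153,5,0),(97,5,5),(76,5,5),(40,2,1),
     (18,7,5),(8,7,4),(6,7,3),(5,7,5),(174,5,2),(152,5,1),(56,5,1),(52,2,2),(28,4,1),(4,7,5),
     (3,7,3),(2,7,3),(172,5,4),(95,5,4),(55,2,0),(86,2,1),(66,4,0),(18,4,3),(1,7,5),(43,7,3),
     (151,5,4),(94,5,4),(51,2,1),(34,2,4),(22,4,3),(8,4,1),(4,4,3),(0,7,4),(171,5,4),(150,2,5),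
     (54,2,5),(49,2,5),(33,2,2),(41,4,5),(6,4,5),(3,4,5),(1,4,3),(170,2,3),(93,2,5),(53,2,5),
     (48,2,3),(32,2,5),(19,4,3),(5,4,3),(2,4,5),(43,4,5),(0,4,1)]
    [E 1 2 3 3 5 7 1 3 [],
    E 1 2 4 4 4 7 1 4 [],
    E 1 4 2 2 5 7 2 4 [],
    E 1 2 3 7 5 5 1 5 [(0,0,1)],
    E 3 6 5 4 6 7 3 4 [],
    E 1 2 2 7 6 6 1 6 [(0,1,2)],
    E 4 6 6 4 7 7 4 4 [],
    E 1 1 2 4 4 2 4 4 [],
    E 1 5 3 1 6 8 3 5 [(0,0,1)],
    E 1 5 2 2 7 6 2 6 [(0,1,0)],
    E 1 1 3 7 5 11 1 7 [(0,1,3)],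
    E 1 3 2 8 11 7 1 7 [(4,0,0),(0,1,0)],
    E 2 2 3 6 6 5 2 5 [],
    E 1 4 3 2 6 7 3 4 [],
    E 1 3 6 11 7 6 1 6 [(1,0,1),(0,0,1),(1,1,0)],
    E 1 1 3 5 4 8 1 5 [],
    E 1 15 3 5 4 8 1 5 [(0,1,0)],
    E 1 1 3 4 4 7 1 4 [],
    E 1 3 5 4 7 10 1 4 [(0,1,0)],
    E 1 15 3 2 8 9 1 2 [],
    E 1 2 8 8 15 1 1 1 [],
    E 2 3 4 4 5 7 2 4 [(17,0,1)],
    E 2 7 4 5 6 9 2 5 [(9,1,1)],
    E 1 5 2 2 12 6 2 6 [(14,1,0)],
    E 1 3 6 12 7 7 1 7 [(0,0,1)],
    E 2 2 3 7 5 6 2 6 [(0,1,1)],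
    E 1 1 4 5 7 2 1 2 [],
    E 1 1 2 5 7 2 2 2 [],
    E 1 2 2 4 4 3 2 3 [],
    E 1 5 2 4 7 6 2 6 [(20,1,2),(19,1,0)],
    E 2 2 3 5 8 4 2 4 [],
    E 1 3 2 10 5 4 2 4 [(0,1,1)],
    E 1 2 2 13 4 3 2 3 [],
    E 1 1 2 5 10 2 2 2 [],
    E 1 1 4 5 10 2 1 2 [],
    E 1 8 4 9 5 7 2 7 [(8,1,1),(7,1,1),(6,0,1),(12,0,3),(5,0,1),(12,3,5),(3,3,0),(2,3,1),(1,6,1),
     (0,6,1)],
    E 1 5 5 11 7 7 1 7 [(6,1,2)],
    E 2 4 5 9 7 6 2 6 [(0,0,0),(27,1,2)],
    E 2 4 6 5 6 9 2 5 [(23,0,1),(25,1,1)],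
    E 1 3 2 1 8 9 2 3 [],
    E 2 3 4 2 8 8 2 2 [],
    E 3 7 6 8 7 5 3 5 [(34,0,0)],
    E 3 7 7 9 9 5 3 5 [(35,0,2),(0,1,4)],
    E 1 2 6 1 7 7 1 1 [],
    E 1 1 2 3 4 6 1 3 [],
    E 1 6 2 3 6 8 1 3 [(0,1,0)],
    E 1 6 3 4 4 7 1 4 [],
    E 1 1 3 4 5 3 3 3 [],
    E 1 2 2 5 5 9 1 5 [(0,0,0)],
    E 1 3 3 8 6 6 1 6 [(36,0,0),(36,1,1)],
    E 1 3 4 8 5 5 1 5 [],
    E 1 2 2 1 4 3 2 3 [],
    E 1 11 2 5 7 4 1 4 [(0,1,2)],
    E 1 11 2 3 7 2 1 2 [],
    E 2 7 2 9 7 8 1 8 [(10,1,2),(8,0,0),(7,0,1),(5,0,3),(4,3,5),(3,3,3),(1,3,0),(0,3,0),(33,6,0)],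
    E 4 7 6 5 7 8 4 5 [(0,1,5)],
    E 3 8 6 9 7 6 3 6 [(0,0,0),(1,1,3)],
    E 1 1 2 4 5 3 1 3 [],
    E 2 2 3 4 6 3 2 3 [],
    E 3 6 4 4 6 7 3 4 [(46,1,4)],
    E 1 1 4 6 6 3 1 3 [],
    E 2 1 3 4 7 3 2 3 [],
    E 3 7 4 4 7 3 3 3 [],
    E 1 2 3 6 6 4 3 4 [(58,1,3)],
    E 1 3 3 7 6 5 3 5 [(57,0,1),(53,1,0)],
    E 1 3 3 7 9 5 3 5 [(58,0,0),(54,1,0)],
    E 1 1 3 4 4 3 3 3 [],
    E 1 1 4 6 11 3 1 3 [],
    E 1 9 4 7 6 10 3 7 [(7,1,1),(6,1,0),(5,0,5),(4,0,0),(3,0,0),(2,3,1),(1,3,1),(6,6,0),(0,6,1)],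
    E 1 1 4 6 6 4 4 4 [],
    E 1 1 2 8 5 7 1 7 [(46,1,3)],
    E 1 2 2 8 5 7 1 7 [(1,0,1),(0,1,0)],
    E 2 3 3 7 6 6 2 6 [(0,1,0)],
    E 3 9 4 6 7 5 3 5 [(0,1,1)],
    E 1 3 4 5 5 9 1 5 [],
    E 3 7 4 4 11 3 3 3 [(0,1,0)],
    E 2 4 3 4 6 3 2 3 [],
    E 1 1 3 3 3 5 1 3 [],
    E 1 7 2 4 12 3 1 3 [(0,1,0)],
    E 4 6 4 8 7 7 3 7 [(21,1,5),(20,1,5),(19,0,0),(10,3,2),(5,3,2),(19,3,3),(3,6,5),(2,6,2),
     (0,6,5)],
    E 2 1 3 4 6 3 2 3 [],
    E 1 3 2 1 6 4 2 4 [],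
    E 1 1 1 3 3 6 3 3 [(0,1,2)],
    E 1 4 2 4 5 3 1 3 [],
    E 2 6 3 4 6 3 2 3 [],
    E 2 1 3 6 8 5 2 5 [],
    E 3 8 4 5 6 4 3 4 [(0,1,4)],
    E 1 4 4 8 5 5 1 5 [],
    E 3 6 4 4 7 3 3 3 [(0,0,0)],
    E 1 6 2 4 11 3 1 3 [(11,1,0)],
    E 4 7 4 9 6 8 3 8 [(6,1,0),(5,1,5),(14,0,0),(30,0,0),(16,3,3),(3,3,2),(1,6,3),(13,6,2),
     (0,6,5)],
    E 1 4 2 1 5 5 2 5 [],
    E 1 4 3 1 4 5 3 4 [(0,1,2)],
    E 1 8 4 6 8 11 3 6 [(32,1,0),(12,1,0),(10,0,0),(29,0,1),(2,3,2),(19,3,0),(0,3,1),(17,3,0),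
     (12,6,0)],
    E 1 2 2 6 6 11 1 6 [(30,1,1)],
    E 2 4 3 2 8 9 3 4 [(80,0,1),(0,1,0)],
    E 1 3 3 2 8 8 3 3 [(92,1,2)],
    E 1 2 5 3 6 8 1 3 [],
    E 1 1 1 2 2 1 2 2 [],
    E 1 5 2 2 5 6 2 6 [(62,1,3)],
    E 1 3 2 2 5 4 2 4 [],
    E 1 3 2 2 4 5 2 3 [],
    E 1 7 1 9 9 8 2 8 [(3,0,0),(62,0,1),(70,0,0),(10,0,1),(2,3,4),(89,3,5),(1,3,1),(0,3,1),
     (67,6,5)],
    E 4 4 5 9 9 5 5 5 [(0,0,0),(0,1,1)],
    E 4 8 7 9 8 6 4 6 [(0,0,0),(49,5,1)],
    E 1 6 2 3 6 2 1 2 [],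
    E 2 6 3 3 6 2 2 2 [],
    E 2 6 3 6 6 5 2 5 [(94,1,1)],
    E 2 10 3 7 6 6 2 6 [(34,1,5),(36,1,0)],
    E 2 11 3 5 6 4 2 4 [(105,1,1)],
    E 2 11 3 4 6 3 2 3 [],
    E 2 6 3 3 11 2 2 2 [],
    E 1 6 2 3 11 2 1 2 [],
    E 3 7 3 9 6 8 2 8 [(7,1,5),(6,0,0),(28,0,0),(5,0,0),(4,3,0),(3,3,0),(2,3,0),(1,6,5),(0,6,5)],
    E 5 8 7 6 8 9 5 6 [(77,3,0),(0,5,1),(103,5,3)],
    E 1 1 2 3 6 2 1 2 [],
    E 2 6 3 3 3 4 2 3 [(114,1,0)],
    E 2 6 5 5 6 9 2 5 [(57,0,0),(53,1,1)],
    E 2 8 5 9 7 6 2 6 [(76,0,0),(111,0,3),(18,1,2)],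
    E 2 15 3 6 6 5 2 5 [(106,1,1)],
    E 2 11 3 5 8 4 2 4 [(89,1,0)],
    E 1 2 2 11 3 3 2 2 [],
    E 1 8 2 3 11 2 1 2 [],
    E 3 7 3 9 8 8 2 8 [(7,1,5),(6,0,1),(92,0,3),(5,0,1),(4,3,4),(3,3,3),(2,3,0),(1,3,3),(0,6,5)],
    E 4 9 7 10 8 7 4 7 [(9,0,0),(0,5,1),(113,5,2)],
    E 1 2 2 4 6 3 2 3 [],
    E 2 7 6 6 7 11 2 6 [(84,0,0),(84,1,5)],
    E 1 2 2 13 6 3 2 3 [],
    E 1 8 5 7 6 11 2 7 [(101,1,0),(100,1,0),(2,0,0),(105,0,2),(1,0,0),(10,3,3),(125,3,1),(0,3,0),
     (93,6,0)],
    E 1 3 3 6 7 4 1 4 [],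
    E 1 4 2 7 6 6 1 6 [(116,1,0),(107,1,2)],
    E 1 11 2 3 6 2 1 2 [],
    E 1 6 2 2 11 1 1 1 [],
    E 2 7 2 9 6 8 1 8 [(89,1,2),(27,0,0),(3,0,3),(58,0,3),(2,3,5),(45,3,3),(54,3,2),(1,3,0),
     (0,6,5)],
    E 4 6 6 5 7 8 4 5 [(5,0,3),(0,1,5)],
    E 4 8 7 7 8 4 4 4 [(93,0,0),(93,1,4)],
    E 2 3 5 7 6 4 2 4 [(132,0,0)],
    E 1 2 4 7 14 4 1 4 [],
    E 5 7 7 5 8 8 5 5 [(83,3,1),(83,5,4)],
    E 3 1 4 5 5 7 3 5 [(39,0,2),(39,1,3)],
    E 1 2 2 7 11 6 1 6 [(76,1,0)],
    E 2 3 4 7 10 5 2 5 [(0,0,0),(49,1,2)],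
    E 1 2 4 8 9 5 1 5 [(111,0,1),(94,1,0)],
    E 2 4 7 11 10 6 2 6 [(106,0,1),(101,1,4)],
    E 6 9 8 7 9 10 6 7 [(127,3,5),(35,3,4),(64,5,1),(0,5,2),(127,5,2)],
    E 1 4 6 11 7 6 1 6 [(59,1,0)],
    E 2 7 6 9 8 5 2 5 [(59,0,1),(141,1,2)],
    E 1 1 3 4 10 13 1 4 [],
    E 1 2 1 3 2 10 2 3 [(0,1,0)],
    E 1 8 5 10 8 7 2 7 [(121,1,0),(116,0,0),(117,0,0),(57,0,1),(30,0,0),(40,3,3),(2,3,2),(0,3,0),
     (115,6,0),(114,6,0)],
    E 6 8 8 6 9 9 6 6 [(4,3,0),(0,3,3),(0,5,5),(4,5,2)],
    E 2 2 3 5 6 3 3 3 [(147,1,1)],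
    E 2 3 3 6 6 4 3 4 [(66,1,1)],
    E 1 2 3 5 5 9 1 5 [],
    E 1 3 2 2 3 11 3 3 [(0,1,2)],
    E 1 2 2 6 6 3 2 3 [],
    E 2 7 6 9 8 6 3 6 [(30,1,1),(4,1,1),(63,0,4),(114,0,0),(87,3,1),(3,3,1),(1,3,2),(0,6,0),
     (58,6,0)],
    E 2 7 7 11 8 6 2 6 [(115,0,1),(21,0,2),(30,1,1)],
    E 1 2 2 7 12 6 1 6 [(94,1,0),(152,1,0)],
    E 1 1 6 12 9 7 1 7 [(32,0,3),(94,0,1)],
    E 3 6 7 12 9 8 3 8 [(123,3,2),(36,3,0),(69,1,4),(0,5,3)],
    E 2 5 6 11 8 7 2 7 [(106,0,2),(32,1,3)],
    E 5 9 7 7 8 10 5 7 [(16,3,0),(1,5,2),(0,5,0),(16,5,0)],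
    E 1 2 3 5 4 3 1 3 [],
    E 1 2 2 1 7 3 2 3 [],
    E 2 2 3 5 7 3 3 3 [],
    E 3 7 5 7 6 5 3 5 [(159,0,1),(129,1,4)],
    E 1 2 3 5 13 3 1 3 [],
    E 2 8 5 9 6 7 3 7 [(4,1,0),(3,1,1),(2,1,0),(1,0,0),(11,0,1),(1,3,5),(15,3,0),(2,6,0),(12,6,1),
     (0,6,0)],
    E 2 4 4 2 7 7 4 4 [],
    E 1 5 2 3 7 6 2 6 [(0,0,2),(70,1,0)],
    E 1 1 3 9 9 7 1 7 [(62,0,4),(0,1,0)],
    E 4 4 7 9 9 6 4 6 [(69,0,0),(92,0,3),(69,1,1)],
    E 1 3 3 3 7 1 1 1 [],
    E 1 7 3 3 3 5 1 3 [],
    E 1 4 3 5 4 8 1 5 [(159,1,0)],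
    E 1 5 5 6 6 11 1 6 [(80,1,0)],
    E 1 10 3 4 4 7 1 4 [],
    E 1 10 3 3 3 5 1 3 [],
    E 1 10 3 2 3 4 1 2 [],
    E 1 3 3 3 10 1 1 1 [],
    E 2 8 3 6 3 10 1 8 [(7,1,4),(68,0,2),(6,0,0),(5,0,4),(4,3,3),(3,3,0),(2,3,1),(1,3,1),(0,6,5)],
    E 3 2 5 8 9 6 3 6 [(32,0,4),(126,0,2),(0,1,1)],
    E 3 7 5 5 7 9 3 5 [(110,1,1)],
    E 2 8 6 10 7 6 2 6 [(142,0,0),(177,0,0),(0,1,3)],
    E 1 1 4 9 5 6 1 6 [(99,0,1)],
    E 3 3 7 9 9 5 3 5 [(14,0,0),(176,0,3)],
    E 2 2 4 5 6 9 2 5 [(1,0,1)],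
    E 1 1 4 5 5 9 1 5 [(166,0,2)],
    E 2 2 5 4 9 11 2 4 [(35,0,1)],
    E 1 9 3 3 9 11 1 3 []]"
    by code_simp
  from cops_win_if_certify[OF this] show ?thesis
    by (simp add: numeral_3_eq_3)
qed

lemma cops_win_17: "cops_win (queen_graph 17) 3"
proof -
  have "certify (int 17) [] [(8,8),(9,9),(10,10)]
    [(232,0,0),(231,0,0),(228,0,0),(226,0,2),(222,0,3),(218,0,3),(216,3,1),(215,3,1),(214,3,0),
     (213,3,0),(212,3,0),(232,1,0),(210,0,0),(208,0,2),(204,0,5),(203,0,5),(176,0,1),(176,3,3),
     (203,3,2),(173,3,0),(172,3,0),(212,6,5),(231,1,0),(210,1,0),(170,0,0),(169,0,3),(156,0,1),
     (122,0,3),(116,3,3),(156,3,3),(114,3,5),(172,6,5),(228,1,0),(208,1,2),(170,1,0),(98,0,4),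
     (81,0,1),(59,0,4),(42,3,4),(41,3,4),(114,6,0),(213,6,5),(226,1,2),(204,1,5),(169,1,3),
     (98,1,4),(31,0,1),(25,0,4),(31,3,5),(41,6,2),(173,6,5),(214,6,5),(222,1,3),(203,1,5),
     (156,1,1),(81,1,1),(31,1,1),(8,0,2),(0,3,2),(31,6,0),(156,6,1),(203,6,4),(215,6,3),(218,1,3),
     (176,1,1),(122,1,3),(59,1,4),(25,1,4),(8,1,2),(0,6,4),(42,6,2),(116,6,1),(176,6,1),(120,6,2),
     (110,5,4),(176,5,3),(116,5,3),(42,5,4),(0,5,2),(8,7,4),(25,7,2),(59,7,2),(122,7,1),(176,7,3),
     (218,7,1),(215,5,1),(203,5,2),(156,5,3),(31,5,5),(0,2,4),(8,4,4),(31,7,3),(81,7,3),(156,7,3),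
     (203,7,0),(222,7,1),(209,5,2),(173,5,0),(41,5,4),(31,2,0),(25,4,2),(31,4,3),(98,7,2),
     (169,7,1),(204,7,0),(226,7,4),(213,5,0),(114,5,5),(41,2,2),(42,2,2),(59,4,2),(81,4,3),
     (98,4,2),(170,7,5),(208,7,4),(228,7,5),(172,5,0),(114,2,0),(156,2,1),(116,2,1),(122,4,1),
     (156,4,3),(169,4,1),(170,4,5),(210,7,5),(231,7,5),(212,5,0),(172,2,5),(173,2,5),(203,2,4),
     (176,2,1),(176,4,3),(203,4,0),(204,4,0),(208,4,4),(210,4,5),(232,7,5),(212,2,5),(213,2,5),
     (214,2,5),(215,2,3),(216,2,3),(218,4,1),(222,4,1),(226,4,4),(228,4,5),(231,4,5),(232,4,5)]
    [E 1 1 2 2 9 10 1 2 [],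
    E 1 1 3 3 8 10 1 3 [],
    E 1 2 2 5 4 3 2 3 [],
    E 2 1 3 4 6 3 2 3 [],
    E 1 1 4 4 7 10 1 4 [(1,0,1),(0,1,0)],
    E 1 3 2 2 8 4 2 4 [],
    E 1 1 4 8 5 5 1 5 [(0,0,1)],
    E 2 1 3 6 8 5 2 5 [],
    E 1 4 2 2 6 5 2 5 [],
    E 1 4 2 3 3 1 3 4 [(0,1,1)],
    E 1 1 3 8 9 6 1 6 [(2,0,0),(0,1,5)],
    E 1 1 2 4 4 2 4 4 [],
    E 1 5 3 1 6 8 3 5 [(0,0,1)],
    E 1 5 2 2 7 6 2 6 [(0,1,0)],
    E 1 1 2 8 9 7 1 7 [(1,0,1),(0,1,0)],
    E 1 5 2 2 12 6 2 6 [(2,1,0)],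
    E 1 3 6 12 7 7 1 7 [(0,0,1)],
    E 1 3 3 8 6 6 1 6 [(8,0,1),(9,1,1)],
    E 1 3 5 9 7 5 1 5 [],
    E 1 3 4 4 5 8 1 4 [(15,1,0)],
    E 1 17 2 2 7 8 1 2 [],
    E 1 1 3 4 6 9 1 4 [],
    E 2 2 3 3 9 10 2 3 [(17,0,0),(0,1,0)],
    E 1 1 3 5 4 8 1 5 [],
    E 2 2 8 4 8 10 2 4 [(0,0,1)],
    E 1 1 3 6 4 9 1 6 [(17,1,0)],
    E 1 4 3 2 6 7 3 4 [],
    E 1 4 3 1 5 6 3 4 [(0,1,2)],
    E 2 2 6 9 8 5 2 5 [(2,0,0),(1,0,2),(0,1,3)],
    E 2 2 7 11 8 6 2 6 [(12,0,0),(16,0,2)],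
    E 1 1 6 7 7 2 1 2 [],
    E 1 2 2 7 3 3 2 3 [(26,1,1)],
    E 1 3 2 2 5 4 2 4 [],
    E 2 7 4 5 6 9 2 5 [(25,1,2)],
    E 1 5 5 11 7 7 1 7 [(18,1,1)],
    E 1 5 2 2 5 6 2 6 [(0,1,3)],
    E 1 1 4 2 5 6 1 2 [],
    E 1 1 2 4 6 2 2 2 [],
    E 1 2 2 4 6 3 2 3 [],
    E 4 6 6 4 7 7 4 4 [],
    E 3 7 6 8 7 5 3 5 [(0,0,0)],
    E 2 7 6 6 7 11 2 6 [(0,0,0),(0,1,5)],
    E 2 4 4 2 7 7 4 4 [],
    E 3 7 7 9 9 5 3 5 [(3,0,2),(2,1,4)],
    E 1 5 2 14 7 6 2 6 [(1,0,2),(0,1,5),(8,1,0)],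
    E 1 4 2 14 6 5 2 5 [(36,1,0)],
    E 2 1 3 5 6 4 2 4 [],
    E 1 4 2 3 5 7 2 4 [(0,1,0)],
    E 1 1 1 2 2 14 2 2 [],
    E 1 1 5 6 14 2 1 2 [],
    E 1 8 5 7 6 11 2 7 [(13,1,0),(12,0,0),(11,0,0),(16,0,2),(8,0,0),(5,3,0),(4,3,0),(2,3,1),
     (1,3,1),(0,6,1)],
    E 1 3 2 16 5 4 2 4 [(18,1,0)],
    E 1 1 3 4 5 8 1 4 [],
    E 1 2 2 11 7 3 2 3 [(0,1,1)],
    E 1 1 2 7 11 2 2 2 [],
    E 1 1 6 7 11 2 1 2 [],
    E 1 8 5 10 7 7 2 7 [(25,1,1),(24,0,0),(23,0,1),(22,0,3),(20,0,1),(5,3,0),(4,3,1),(2,3,0),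
     (1,6,1),(0,6,1)],
    E 1 2 3 3 9 4 3 4 [(49,0,0)],
    E 1 2 4 9 6 6 1 6 [(50,0,1)],
    E 2 4 5 5 5 8 2 5 [(41,0,1),(1,1,0),(0,1,1)],
    E 1 3 2 2 7 8 2 3 [(38,1,2)],
    E 2 3 3 6 10 5 2 5 [(32,1,1)],
    E 3 3 9 4 9 10 3 4 [(3,0,5),(0,0,3),(33,1,1)],
    E 3 3 7 9 9 5 3 5 [(28,0,0),(49,0,3)],
    E 1 2 5 5 6 1 1 1 [],
    E 1 6 2 2 5 6 1 2 [],
    E 1 6 2 4 5 3 1 3 [],
    E 1 6 2 6 5 5 1 5 [(20,1,1)],
    E 1 1 4 6 6 4 4 4 [],
    E 1 12 2 8 5 7 1 7 [(0,0,1),(55,1,5),(54,1,0)],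
    E 1 12 2 6 5 5 1 5 [(23,1,1)],
    E 1 12 2 5 5 4 1 4 [(18,1,1)],
    E 1 12 2 4 5 3 1 3 [],
    E 1 5 2 2 12 1 1 1 [],
    E 2 7 2 9 5 8 1 8 [(9,1,4),(8,0,0),(7,0,0),(6,0,0),(4,3,0),(3,3,0),(2,3,0),(1,3,0),(8,3,3),
     (0,6,5)],
    E 4 7 6 5 7 8 4 5 [(0,1,3)],
    E 3 8 7 10 9 6 3 6 [(0,0,2),(0,1,2),(1,1,2)],
    E 1 7 3 2 8 9 1 2 [],
    E 1 7 3 3 7 9 1 3 [],
    E 1 1 2 7 3 6 1 6 [(21,1,1),(71,1,0)],
    E 1 1 2 4 3 6 1 4 [],
    E 2 2 3 6 6 5 2 5 [],
    E 1 3 5 6 6 11 1 6 [(0,0,0)],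
    E 1 12 3 5 5 9 1 5 [(36,1,1)],
    E 1 12 2 4 4 7 1 4 [(30,1,2)],
    E 1 12 2 3 8 2 1 2 [],
    E 1 8 2 2 12 1 1 1 [],
    E 2 7 2 9 8 8 1 8 [(21,0,1),(8,0,1),(6,0,5),(19,0,0),(17,3,0),(4,3,5),(3,3,1),(2,3,1),(1,3,0),
     (0,6,5)],
    E 1 11 2 2 3 4 1 2 [],
    E 2 8 3 11 9 9 1 9 [(11,0,0),(10,0,0),(36,0,5),(65,0,5),(9,0,3),(1,3,2),(9,3,3),(8,3,3),
     (87,3,5),(0,3,1)],
    E 1 5 2 3 6 2 1 2 [],
    E 2 5 3 3 6 2 2 2 [],
    E 2 8 3 4 4 3 2 3 [],
    E 2 6 4 4 5 7 2 4 [],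
    E 1 4 4 9 6 6 1 6 [(86,1,1)],
    E 2 6 4 5 5 8 2 5 [(0,1,4)],
    E 1 5 2 3 7 2 1 2 [],
    E 2 5 3 3 7 2 2 2 [],
    E 1 2 2 5 4 4 1 4 [],
    E 2 7 3 4 5 3 2 3 [(0,1,1)],
    E 2 7 3 5 5 4 2 4 [(67,1,2)],
    E 2 6 3 6 6 5 2 5 [(19,1,1)],
    E 3 8 3 10 5 9 2 9 [(5,1,5),(4,1,5),(2,0,0),(1,0,0),(0,0,5),(0,3,3),(1,3,2),(2,3,2),(4,6,3),
     (5,6,3)],
    E 2 12 3 7 6 6 2 6 [(39,1,5),(86,1,4)],
    E 1 2 2 7 6 6 1 6 [(46,1,1)],
    E 2 10 3 6 4 5 2 5 [(96,1,3),(0,1,1)],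
    E 2 10 3 4 4 3 2 3 [],
    E 2 5 3 3 12 2 2 2 [],
    E 1 5 2 3 12 2 1 2 [],
    E 3 7 4 8 5 11 2 8 [(18,1,3),(17,1,3),(16,0,3),(15,0,0),(13,0,0),(6,0,2),(5,3,2),(3,3,3),
     (2,3,3),(1,6,3),(0,6,3)],
    E 3 3 4 8 9 7 3 7 [(20,3,2),(0,1,0)],
    E 1 1 1 2 2 3 2 2 [],
    E 1 1 2 8 5 7 1 7 [(82,1,1)],
    E 2 10 3 7 6 6 2 6 [(72,1,4),(0,1,5)],
    E 1 3 2 10 6 4 2 4 [(90,1,1)],
    E 1 7 1 9 7 8 2 8 [(84,1,4),(3,0,0),(67,0,4),(81,0,1),(64,3,2),(1,3,5),(0,3,1),(61,3,2),
     (60,6,4),(59,6,4)],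
    E 3 1 5 7 7 11 3 7 [(26,3,2),(6,0,0),(0,1,3)],
    E 1 4 2 1 8 5 2 5 [],
    E 3 1 4 4 8 9 3 4 [(92,0,2),(0,0,2),(109,1,2)],
    E 1 8 3 2 7 8 1 2 [],
    E 1 8 2 4 3 3 1 3 [],
    E 1 1 2 6 4 5 1 5 [],
    E 1 17 2 8 5 7 1 7 [(53,0,1),(106,1,5),(9,1,0)],
    E 1 1 2 7 5 6 1 6 [(96,1,0)],
    E 1 3 2 7 5 6 1 6 [(0,1,0)],
    E 1 10 3 5 5 9 1 5 [(78,1,1)],
    E 1 3 4 7 5 4 1 4 [],
    E 1 14 2 3 8 2 1 2 [],
    E 1 8 5 5 10 1 1 1 [],
    E 2 9 5 4 8 8 1 8 [(9,0,0),(8,0,0),(7,0,3),(49,0,3),(16,0,3),(6,3,3),(4,3,3),(3,3,1),(2,3,3),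
     (1,3,2),(0,6,5)],
    E 3 3 4 7 7 6 3 6 [(0,0,4),(42,1,5)],
    E 1 12 3 5 4 8 1 5 [(107,1,0)],
    E 1 12 2 4 3 3 1 3 [],
    E 2 7 2 8 3 10 1 8 [(46,0,0),(13,0,1),(12,0,0),(48,0,5),(62,0,3),(63,3,1),(1,3,1),(48,3,0),
     (0,3,0),(44,3,0),(46,3,5)],
    E 4 9 5 5 7 8 4 5 [(3,0,2),(3,1,4),(0,1,5)],
    E 1 6 2 3 6 2 1 2 [],
    E 2 6 3 3 6 2 2 2 [],
    E 2 6 3 4 6 3 2 3 [],
    E 2 4 3 3 5 2 2 2 [],
    E 2 12 3 7 7 6 2 6 [(99,0,5),(95,1,5),(35,1,0)],
    E 1 2 2 6 5 5 1 5 [],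
    E 2 13 3 5 4 4 2 4 [(0,1,1)],
    E 2 4 3 3 13 2 2 2 [],
    E 1 4 2 3 13 2 1 2 [],
    E 3 6 3 7 4 9 2 7 [(58,1,3),(5,1,5),(51,0,2),(50,0,1),(34,3,1),(4,3,0),(38,3,2),(2,3,0),
     (37,3,2),(1,6,5),(0,6,5)],
    E 2 12 3 6 6 5 2 5 [(63,1,1)],
    E 2 12 3 5 6 4 2 4 [(5,1,1)],
    E 2 12 3 4 6 3 2 3 [],
    E 2 6 3 3 12 2 2 2 [],
    E 1 6 2 3 12 2 1 2 [],
    E 3 7 3 9 6 8 2 8 [(14,1,5),(13,0,0),(12,0,0),(48,0,0),(5,3,1),(4,3,0),(3,3,0),(2,3,0),(1,6,5),
     (0,6,5)],
    E 4 8 6 6 7 9 4 6 [(0,1,3),(61,5,1)],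
    E 2 6 3 3 7 2 2 2 [],
    E 2 7 3 4 6 3 2 3 [],
    E 2 7 3 5 6 4 2 4 [(13,1,1)],
    E 3 8 3 10 6 9 2 9 [(27,1,5),(2,1,5),(1,0,0),(0,0,0),(41,0,2),(41,3,0),(0,3,2),(1,3,2),(2,6,3),
     (27,6,3)],
    E 1 6 3 5 4 8 1 5 [(132,1,0)],
    E 1 3 3 3 8 1 1 1 [],
    E 1 8 3 4 4 7 1 4 [],
    E 3 6 5 4 6 7 3 4 [],
    E 1 5 5 6 6 11 1 6 [(0,1,3)],
    E 2 9 3 7 3 11 1 9 [(3,1,4),(72,0,3),(82,0,4),(2,0,1),(0,0,2),(0,3,3),(2,3,0),(82,3,5),
     (52,3,3),(3,6,5)],
    E 1 5 4 7 5 11 1 7 [(117,1,1),(127,1,1)],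
    E 1 12 3 4 6 9 1 4 [(141,1,0)],
    E 1 12 3 3 6 8 1 3 [],
    E 1 6 3 3 12 1 1 1 [],
    E 2 7 3 10 6 8 1 8 [(79,0,3),(46,0,0),(81,0,4),(9,0,0),(4,0,0),(3,3,5),(2,3,0),(1,3,0),
     (30,3,2),(0,6,5)],
    E 5 8 7 6 8 9 5 6 [(92,3,4),(11,1,3),(0,5,1)],
    E 2 3 3 3 7 2 2 2 [],
    E 2 1 3 7 5 6 2 6 [(100,0,1),(155,1,3)],
    E 3 8 3 10 10 9 2 9 [(1,1,5),(77,0,0),(69,0,0),(162,0,3),(0,0,5),(0,3,3),(162,3,5),(69,3,2),
     (63,3,0),(1,6,3)],
    E 1 1 3 7 5 11 1 7 [(157,1,3)],
    E 2 7 3 10 10 8 1 8 [(14,1,5),(52,0,0),(99,0,2),(13,0,5),(15,0,0),(82,0,0),(0,3,5),(104,3,2),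
     (91,3,3),(7,3,1),(83,3,1)],
    E 4 9 7 10 8 7 4 7 [(5,0,0),(2,1,3),(0,5,1)],
    E 1 1 4 6 8 4 4 4 [(161,1,3)],
    E 1 5 2 1 6 6 2 6 [(162,1,2)],
    E 1 6 3 9 5 7 1 7 [(1,0,1),(0,1,3),(159,1,2)],
    E 1 14 3 2 4 5 1 2 [],
    E 1 4 3 3 14 1 1 1 [],
    E 3 6 3 10 4 8 1 8 [(21,1,0),(59,0,0),(14,0,2),(2,0,0),(17,0,4),(47,3,0),(20,3,2),(14,3,0),
     (1,3,0),(0,6,5)],
    E 1 1 3 4 7 2 1 2 [],
    E 2 2 3 4 4 3 2 3 [],
    E 2 11 3 6 5 5 2 5 [(22,1,4),(77,1,0)],
    E 2 12 3 5 5 4 2 4 [(150,1,2)],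
    E 2 12 3 4 5 3 2 3 [(85,1,1)],
    E 3 7 3 9 5 8 2 8 [(94,1,5),(93,1,5),(85,0,0),(84,0,0),(71,3,3),(2,3,0),(1,3,0),(0,3,0),
     (77,6,5),(76,6,5)],
    E 2 11 4 4 5 7 2 4 [(60,0,0)],
    E 3 8 4 11 9 9 2 9 [(6,1,5),(5,0,3),(45,0,2),(153,0,0),(145,0,1),(1,3,1),(73,3,0),(0,3,1),
     (5,3,3),(156,6,3)],
    E 2 7 3 5 4 4 2 4 [(47,1,1)],
    E 3 8 3 10 9 9 2 9 [(158,1,5),(166,0,3),(0,0,0),(6,0,2),(75,0,2),(75,3,0),(6,3,0),(0,3,2),
     (166,3,5),(158,6,3)],
    E 4 4 5 8 8 7 4 7 [(10,3,5),(2,0,4),(0,1,5),(17,5,4)],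
    E 4 9 7 8 8 5 4 5 [(114,0,0),(56,1,1)],
    E 1 2 2 6 4 9 1 6 [(133,1,1)],
    E 4 6 7 7 8 4 4 4 [(180,1,3)],
    E 1 6 5 7 7 13 1 7 [(0,0,1),(80,1,4)],
    E 1 11 3 5 4 8 1 5 [(171,1,0)],
    E 1 11 3 4 4 7 1 4 [],
    E 1 11 3 3 4 6 1 3 [],
    E 1 11 3 2 4 5 1 2 [],
    E 1 4 3 3 11 1 1 1 [],
    E 2 8 3 10 4 5 1 8 [(113,1,3),(79,0,3),(41,0,0),(7,0,3),(5,3,2),(4,3,0),(3,3,0),(2,3,0),
     (1,3,0),(0,6,5)],
    E 5 8 6 6 8 9 5 6 [(0,3,2),(10,1,4),(45,1,3),(67,5,0)],
    E 6 8 8 6 9 9 6 6 [(167,3,2),(51,3,4),(51,5,1),(30,5,3)],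
    E 2 6 4 4 6 8 2 4 [(62,1,1)],
    E 2 8 3 3 10 2 2 2 [],
    E 1 8 2 3 10 2 1 2 [],
    E 3 7 4 10 8 8 2 8 [(25,1,5),(183,0,3),(2,0,0),(110,0,0),(16,0,0),(155,3,4),(100,3,3),(99,3,3),
     (1,6,3),(0,6,3)],
    E 5 9 8 10 9 7 5 7 [(172,3,1),(4,0,0),(0,5,0),(35,5,2)],
    E 1 4 6 11 7 6 1 6 [(200,1,0)],
    E 2 5 6 11 8 7 2 7 [(121,0,2),(158,1,3)],
    E 2 4 5 6 6 3 2 3 [(207,1,1)],
    E 3 5 6 6 7 3 3 3 [(96,1,0)],
    E 1 1 3 3 3 5 1 3 [],
    E 1 6 2 4 7 3 1 3 [(0,1,0)],
    E 3 6 4 4 7 3 3 3 [(146,0,0)],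
    E 3 8 4 5 6 4 3 4 [(113,1,5)],
    E 4 8 4 10 6 9 3 9 [(2,1,5),(68,1,2),(1,1,5),(0,0,0),(172,0,1),(172,3,4),(0,3,2),(1,6,3),
     (68,6,0),(2,6,3)],
    E 1 5 2 4 5 3 1 3 [],
    E 2 5 5 6 6 3 2 3 [(215,1,1)],
    E 3 7 4 6 5 5 3 5 [(189,1,3),(202,1,0)],
    E 3 5 4 4 7 3 3 3 [],
    E 1 6 3 5 12 3 1 3 [(113,0,0)],
    E 4 7 5 10 6 8 3 8 [(4,1,2),(3,1,4),(10,1,4),(62,0,0),(5,0,0),(2,3,3),(6,3,2),(1,6,2),(84,6,3),
     (0,6,5)],
    E 4 7 6 11 10 8 3 8 [(12,1,5),(11,1,5),(104,0,3),(182,0,0),(6,0,3),(0,3,1),(92,3,3),(3,3,2),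
     (41,6,3),(90,6,2)],
    E 6 9 8 7 9 10 6 7 [(15,3,0),(14,3,0),(0,5,0),(14,5,0),(15,5,0)],
    E 2 6 4 5 6 9 2 5 [(143,1,1)],
    E 2 16 3 5 4 4 2 4 [(85,1,1)],
    E 2 16 3 4 4 3 2 3 [],
    E 2 7 3 3 11 2 2 2 [],
    E 1 7 2 3 11 2 1 2 [],
    E 3 6 4 9 7 7 2 7 [(49,1,5),(48,0,3),(136,0,0),(79,0,0),(44,3,3),(4,3,5),(3,3,3),(2,3,3),
     (1,6,3),(0,6,3)],
    E 1 2 3 6 4 9 1 6 [(205,1,0)],
    E 6 9 9 10 10 7 6 7 [(23,3,1),(22,3,1),(7,1,2),(1,5,0),(0,5,3)]]"
    by code_simp
  from cops_win_if_certify[OF this] show ?thesis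
    by (simp add: numeral_3_eq_3)
qed

text \<open>Indices go up to 417 here, which makes the binary evaluation of \<open>skip\<close>
  matter.\<close>

lemma cops_win_18: "cops_win (queen_graph 18) 3"
proof -
  have "certify (int 18) [] [(9,10),(10,9),(11,11)]
    [(417,0,1),(416,0,1),(414,0,1),(412,0,0),(404,0,0),(371,0,2),(370,3,4),(367,3,2),(365,3,1),
     (362,3,0),(361,3,0),(360,3,0),(359,0,4),(358,0,1),(356,0,3),(322,0,0),(298,0,4),(303,3,3),
     (296,3,5),(295,3,2),(294,3,0),(293,3,1),(292,6,1),(417,1,4),(290,0,5),(277,0,0),(245,0,5),
     (204,0,0),(188,3,4),(185,3,5),(184,3,0),(182,3,3),(181,6,3),(250,6,5),(416,1,4),(359,1,1),
     (177,0,5),(158,0,2),(135,0,5),(132,3,1),(177,3,2),(123,3,0),(122,6,3),(121,6,1),(414,1,4),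
     (358,1,4),(290,1,3),(98,0,4),(84,0,5),(78,3,5),(68,3,5),(67,6,3),(66,6,5),(65,6,1),(412,1,2),
     (356,1,5),(277,1,2),(177,1,3),(57,0,1),(52,3,0),(68,6,5),(47,6,5),(46,6,2),(392,6,4),
     (404,1,2),(322,1,2),(245,1,3),(158,1,0),(98,1,1),(52,6,1),(78,6,5),(44,6,0),(167,6,3),
     (43,6,4),(371,1,0),(298,1,1),(204,1,2),(135,1,3),(84,1,3),(57,1,4),(34,6,2),(57,6,4),(23,6,4),
     (15,6,4),(8,6,0),(0,6,1),(370,5,1),(303,5,5),(19,5,3),(132,5,4),(78,5,3),(52,5,2),(34,2,5),
     (98,7,4),(158,7,2),(245,7,5),(64,7,4),(404,7,0),(367,5,0),(296,5,3),(185,5,3),(177,5,0),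
     (68,5,3),(52,2,5),(57,2,1),(177,7,5),(94,7,3),(356,7,3),(62,7,3),(365,5,4),(295,5,0),
     (184,5,2),(123,5,2),(68,2,3),(78,2,3),(98,4,1),(290,7,5),(358,7,1),(414,7,1),(362,5,2),
     (294,5,2),(182,5,5),(67,2,5),(47,2,3),(23,2,1),(158,4,0),(177,4,3),(359,7,4),(416,7,1),
     (361,5,2),(293,5,4),(122,2,5),(66,2,3),(44,2,2),(15,2,1),(245,4,3),(94,4,5),(290,4,3),
     (417,7,1),(360,5,2),(181,2,5),(121,2,4),(46,2,0),(167,2,5),(8,2,2),(63,4,4),(356,4,5),
     (358,4,4),(359,4,1),(292,2,4),(250,2,3),(65,2,4),(392,2,1),(43,2,1),(0,2,4),(404,4,2),
     (62,4,5),(414,4,4),(416,4,4),(417,4,4)]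
    [E 1 2 3 3 7 9 1 3 [],
    E 1 2 4 4 6 9 1 4 [],
    E 1 3 2 2 5 4 2 4 [],
    E 1 2 5 5 5 9 1 5 [(0,0,0)],
    E 2 1 3 6 8 5 2 5 [],
    E 1 2 4 9 6 6 1 6 [(0,0,1)],
    E 1 1 2 4 4 2 4 4 [],
    E 1 5 3 1 6 8 3 5 [(0,0,1)],
    E 1 5 2 2 12 6 2 6 [(0,1,0)],
    E 1 1 2 8 5 7 1 7 [(0,1,3)],
    E 2 2 3 7 8 6 2 6 [(0,1,0)],
    E 2 4 4 2 7 7 4 4 [],
    E 3 1 5 7 9 5 3 5 [(1,0,0),(0,0,2)],
    E 1 2 3 9 7 7 1 7 [(2,0,0),(0,1,1)],
    E 1 3 4 4 8 1 1 1 [],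
    E 1 8 3 2 4 5 1 2 [],
    E 1 8 3 3 4 6 1 3 [],
    E 1 5 2 1 6 6 2 6 [(9,1,2)],
    E 1 5 2 1 8 6 2 6 [(11,0,0),(0,1,2)],
    E 1 4 2 8 5 7 1 7 [(0,1,3),(9,1,0)],
    E 1 1 4 5 6 4 4 4 [(2,0,2)],
    E 1 5 2 2 7 6 2 6 [(13,1,0)],
    E 1 1 3 7 5 11 1 7 [(0,1,3)],
    E 1 5 2 3 6 6 2 6 [(0,1,5)],
    E 1 11 3 7 5 11 1 7 [(3,1,1),(0,1,5),(1,1,0)],
    E 1 1 3 6 4 9 1 6 [(20,1,0)],
    E 1 11 3 6 4 9 1 6 [(21,1,0),(0,1,0)],
    E 1 1 3 5 4 8 1 5 [],
    E 1 11 3 5 4 8 1 5 [(0,1,0)],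
    E 1 11 3 4 4 7 1 4 [],
    E 1 11 3 3 4 6 1 3 [],
    E 1 11 3 2 4 5 1 2 [],
    E 1 4 3 3 11 1 1 1 [],
    E 2 9 3 6 4 8 1 8 [(18,1,4),(17,0,0),(16,0,0),(13,0,2),(8,3,0),(6,3,0),(4,3,0),(3,3,0),(2,3,0),
     (1,3,0),(0,6,5)],
    E 3 7 6 8 7 5 3 5 [(22,0,4)],
    E 2 7 6 6 7 11 2 6 [(0,0,0),(0,1,5)],
    E 1 1 4 6 6 4 4 4 [],
    E 1 1 5 7 6 12 1 7 [(1,0,2)],
    E 1 11 5 7 6 12 1 7 [(2,0,2),(1,0,0),(0,1,0)],
    E 1 1 3 4 4 3 3 3 [],
    E 1 1 2 5 4 8 1 5 [],
    E 1 11 2 5 4 8 1 5 [(1,0,0),(0,1,0)],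
    E 1 1 3 3 3 5 1 3 [],
    E 1 17 2 4 8 3 1 3 [(0,1,0)],
    E 1 17 2 3 8 2 1 2 [],
    E 1 8 4 4 11 1 1 1 [],
    E 2 9 4 5 8 8 1 8 [(45,0,4),(44,0,4),(40,0,2),(32,0,2),(12,3,1),(7,3,3),(19,3,1),(4,3,1),
     (2,3,2),(1,3,2),(0,6,5)],
    E 1 1 2 8 9 7 1 7 [(39,0,1),(25,1,0)],
    E 3 6 5 4 6 7 3 4 [],
    E 1 2 3 6 9 4 3 4 [(0,1,2)],
    E 1 1 4 9 9 6 1 6 [(45,0,1),(0,0,1)],
    E 1 3 2 2 8 4 2 4 [],
    E 1 17 4 8 5 5 1 5 [(0,0,1)],
    E 1 2 2 5 4 3 2 3 [],
    E 2 1 3 4 6 3 2 3 [],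
    E 1 17 4 4 5 8 1 4 [(1,0,1),(0,1,0)],
    E 1 17 3 3 6 8 1 3 [],
    E 1 17 2 2 7 8 1 2 [],
    E 2 1 4 4 8 10 2 4 [(30,0,1)],
    E 2 3 5 5 6 9 2 5 [(53,0,1)],
    E 1 3 6 12 7 7 1 7 [(51,0,1)],
    E 2 2 5 6 5 9 2 6 [(38,0,1),(48,0,0),(0,1,0)],
    E 1 4 3 2 6 7 1 2 [],
    E 2 5 4 4 5 7 2 4 [],
    E 1 5 2 3 8 2 1 2 [],
    E 2 5 3 3 8 2 2 2 [],
    E 2 5 3 3 4 5 2 3 [],
    E 1 2 2 5 4 4 1 4 [],
    E 2 7 3 4 5 3 2 3 [(0,1,1)],
    E 2 7 3 5 5 4 2 4 [(66,1,2)],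
    E 2 6 3 6 6 5 2 5 [(10,1,4)],
    E 2 11 3 6 5 5 2 5 [(22,1,4),(45,1,5)],
    E 2 12 3 5 5 4 2 4 [(69,1,2)],
    E 2 12 3 4 5 3 2 3 [(5,1,1)],
    E 3 8 3 10 5 9 2 9 [(9,1,5),(8,1,5),(5,0,0),(4,0,0),(3,0,5),(38,3,5),(2,3,0),(1,3,0),(0,3,0),
     (8,6,3),(9,6,3)],
    E 4 6 6 4 7 7 4 4 [],
    E 2 7 3 7 10 6 2 6 [(0,0,5),(41,1,4),(15,1,4)],
    E 2 5 3 3 11 2 2 2 [],
    E 1 5 2 3 11 2 1 2 [],
    E 3 7 4 10 5 8 2 8 [(14,1,3),(13,1,3),(12,0,3),(15,0,5),(4,0,0),(2,3,2),(7,3,2),(9,3,2),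
     (10,3,2),(1,6,3),(0,6,3)],
    E 2 6 3 4 4 3 2 3 [],
    E 2 7 4 4 5 7 2 4 [(40,0,2)],
    E 2 2 3 6 6 5 2 5 [],
    E 2 12 4 5 6 9 2 5 [(56,0,0),(0,1,1)],
    E 2 12 4 4 5 7 2 4 [(55,0,0)],
    E 2 13 3 4 4 3 2 3 [],
    E 3 8 4 11 5 9 2 9 [(7,1,3),(8,1,3),(5,0,3),(4,0,0),(14,0,2),(11,3,2),(2,3,0),(1,3,0),(0,3,3),
     (20,6,3),(21,6,3)],
    E 2 7 4 6 7 11 2 6 [(52,1,5),(76,1,1)],
    E 1 2 3 6 6 11 1 6 [(38,1,0)],
    E 2 7 4 5 7 10 2 5 [(84,1,2),(0,1,0)],
    E 1 2 2 6 5 5 1 5 [],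
    E 2 17 4 4 4 6 2 4 [(38,0,0),(0,1,0)],
    E 2 16 4 3 7 8 2 3 [(36,0,0)],
    E 2 4 7 7 16 2 2 2 [(36,1,3)],
    E 1 7 3 4 16 2 1 2 [(49,1,5)],
    E 4 5 4 9 7 7 2 7 [(32,1,2),(31,0,0),(73,0,1),(15,0,3),(8,3,3),(7,3,5),(5,3,3),(3,3,5),(2,3,0),
     (1,6,4),(0,6,5)],
    E 1 1 6 7 8 2 1 2 [],
    E 1 1 1 2 2 8 2 2 [],
    E 1 3 2 3 5 4 2 4 [(95,1,0)],
    E 2 8 5 9 7 6 2 6 [(64,0,0),(23,0,3),(77,1,2)],
    E 1 1 6 7 7 2 1 2 [],
    E 1 2 2 2 6 3 2 3 [],
    E 1 1 2 6 4 5 1 5 [],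
    E 1 3 2 7 4 4 2 4 [(0,1,1)],
    E 1 4 2 2 6 5 2 5 [],
    E 1 4 2 17 6 5 2 5 [(0,1,0)],
    E 1 2 2 17 6 3 2 3 [],
    E 1 1 2 7 12 2 2 2 [],
    E 1 8 6 11 7 7 2 7 [(7,1,1),(6,0,1),(4,0,0),(36,0,2),(72,0,0),(21,3,3),(20,3,5),(2,3,1),
     (1,3,1),(0,6,1),(11,6,1)],
    E 1 2 2 2 4 3 2 3 [],
    E 1 4 3 2 6 7 3 4 [],
    E 1 1 2 7 5 6 1 6 [(0,1,0)],
    E 1 4 2 7 4 5 2 5 [(7,1,0),(0,1,0)],
    E 1 2 2 17 4 3 2 3 [],
    E 1 8 4 9 7 7 2 7 [(13,1,1),(4,0,1),(10,0,0),(24,0,0),(92,0,1),(27,3,3),(26,3,5),(1,3,1),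
     (10,3,1),(0,3,1),(6,6,1),(17,6,1)],
    E 1 3 2 16 5 4 2 4 [(56,1,1)],
    E 1 1 3 4 5 8 1 4 [],
    E 1 2 2 11 7 3 2 3 [(0,1,1)],
    E 1 1 2 7 11 2 2 2 [],
    E 1 9 5 11 7 8 2 8 [(22,1,1),(21,0,1),(20,0,1),(59,0,5),(19,0,0),(10,0,0),(4,3,0),(3,3,1),
     (1,3,0),(0,6,1),(22,6,1)],
    E 3 2 5 7 7 5 3 5 [(102,0,3),(108,0,2)],
    E 2 8 6 6 7 11 2 6 [(86,0,0),(0,1,1)],
    E 2 2 6 9 8 5 2 5 [(96,0,0),(72,0,0),(72,1,1)],
    E 2 16 4 4 6 8 2 4 [(70,0,1),(32,1,1)],
    E 2 2 6 3 9 10 2 3 [(122,0,3)],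
    E 1 1 8 9 18 2 1 2 [],
    E 1 5 5 11 7 7 1 7 [(108,1,2)],
    E 3 3 7 9 9 5 3 5 [(0,0,0),(105,0,3)],
    E 1 5 2 3 7 6 2 6 [(116,0,2),(110,1,0)],
    E 1 4 3 7 5 11 1 7 [(0,1,3),(106,1,0)],
    E 1 3 3 3 8 1 1 1 [],
    E 1 8 3 2 3 4 1 2 [],
    E 1 6 5 7 6 12 1 7 [(95,0,0),(94,1,0)],
    E 1 11 3 3 3 5 1 3 [],
    E 1 11 3 2 3 4 1 2 [],
    E 1 3 3 3 11 1 1 1 [],
    E 2 9 3 7 3 11 1 9 [(5,1,4),(4,0,0),(119,0,1),(106,0,5),(109,0,5),(3,3,3),(107,3,0),(106,3,0),
     (2,3,1),(1,3,1),(0,6,5)],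
    E 3 6 3 8 4 11 1 8 [(122,1,4),(121,0,0),(120,0,0),(95,0,3),(7,0,0),(0,0,2),(112,3,1),(110,3,0),
     (107,3,0),(106,3,0),(105,3,0),(104,6,5)],
    E 1 6 2 1 6 7 2 7 [(29,1,2)],
    E 1 6 2 3 8 7 2 7 [(0,1,0)],
    E 3 4 6 9 11 6 3 6 [(2,0,3),(0,0,3),(2,1,4)],
    E 2 6 5 8 6 5 2 5 [(92,0,0)],
    E 2 8 3 7 6 6 2 6 [(21,1,1),(128,1,1)],
    E 3 7 5 11 6 8 2 8 [(78,1,2),(77,1,2),(69,0,3),(1,0,0),(56,0,0),(68,3,3),(0,3,2),(73,3,3),
     (74,3,3),(65,6,2),(64,6,2)],
    E 1 2 5 5 7 1 1 1 [],
    E 1 7 2 4 5 3 1 3 [],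
    E 1 7 2 5 5 4 1 4 [(29,1,1)],
    E 1 8 2 7 5 6 1 6 [(98,1,2),(35,1,0)],
    E 1 12 2 8 5 7 1 7 [(127,1,1),(129,1,3),(138,1,0)],
    E 2 1 3 5 4 4 2 4 [],
    E 1 12 2 6 5 5 1 5 [(0,1,1)],
    E 1 12 2 5 5 4 1 4 [(34,1,1)],
    E 1 12 2 4 5 3 1 3 [],
    E 1 12 2 3 5 2 1 2 [],
    E 1 5 2 2 12 1 1 1 [],
    E 2 8 2 10 5 9 1 9 [(10,1,4),(90,0,5),(9,0,0),(8,0,0),(7,0,0),(6,3,0),(4,3,0),(3,3,0),(2,3,0),
     (1,3,0),(0,6,5)],
    E 2 2 5 7 7 5 5 5 [(0,0,1),(0,1,0)],
    E 1 8 2 3 3 2 1 2 [],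
    E 1 3 3 4 4 7 1 4 [],
    E 1 3 2 5 5 9 1 5 [(107,1,0)],
    E 1 3 5 6 6 11 1 6 [(47,0,1)],
    E 1 3 2 8 7 7 1 7 [(150,1,1)],
    E 2 1 3 7 6 6 2 6 [(41,1,1)],
    E 1 6 3 9 7 7 1 7 [(150,1,1),(0,1,1)],
    E 1 16 3 5 4 8 1 5 [(136,1,0)],
    E 1 2 2 5 6 3 2 3 [],
    E 1 11 3 6 7 4 1 4 [(0,0,0)],
    E 1 11 3 3 7 9 1 3 [],
    E 1 11 3 2 7 8 1 2 [],
    E 1 7 3 3 11 1 1 1 [],
    E 2 9 3 11 7 3 1 9 [(39,1,4),(12,0,1),(11,0,5),(10,0,3),(9,0,3),(8,0,3),(6,3,2),(5,3,5),
     (3,3,0),(2,3,0),(1,3,0),(0,6,5)],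
    E 1 3 2 6 4 2 4 6 [(14,0,2),(0,1,3)],
    E 3 3 5 9 9 7 3 7 [(28,0,1),(0,0,0),(28,1,1)],
    E 1 3 7 1 9 9 1 1 [],
    E 1 7 3 3 7 9 1 3 [],
    E 1 1 3 4 3 6 1 4 [],
    E 1 7 3 4 6 9 1 4 [(0,1,0)],
    E 1 7 3 5 5 9 1 5 [(27,1,1)],
    E 1 7 3 6 4 9 1 6 [(173,1,0),(152,1,0)],
    E 1 7 2 2 4 5 1 2 [],
    E 1 1 2 3 2 4 1 3 [],
    E 1 7 2 3 4 6 1 3 [(0,1,0)],
    E 1 7 2 4 4 7 1 4 [(101,1,1)],
    E 1 12 2 7 4 6 1 6 [(134,0,5),(60,1,4),(177,1,2)],
    E 1 12 2 4 4 3 1 3 [(141,1,0)],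
    E 1 12 2 3 4 2 1 2 [],
    E 1 4 2 2 12 1 1 1 [],
    E 2 8 2 10 4 9 1 9 [(141,0,1),(7,0,0),(5,0,0),(4,0,0),(145,0,2),(3,3,0),(145,3,0),(4,3,3),
     (2,3,0),(1,3,0),(0,6,5)],
    E 1 12 2 2 3 4 1 2 [],
    E 2 8 3 11 10 9 1 9 [(15,1,2),(57,0,1),(14,0,0),(12,0,0),(11,0,0),(10,0,0),(1,3,1),(166,3,5),
     (148,3,3),(72,3,5),(55,3,1),(0,3,1)],
    E 2 8 3 4 4 3 2 3 [],
    E 2 8 3 5 4 4 2 4 [(100,1,1)],
    E 2 10 3 7 6 6 2 6 [(71,1,1),(178,1,1)],
    E 1 2 2 4 4 3 2 3 [],
    E 2 8 5 9 6 6 2 6 [(159,0,0),(180,1,1)],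
    E 1 4 6 11 7 6 1 6 [(190,1,0)],
    E 1 4 2 15 4 5 2 5 [(91,1,0),(0,1,0)],
    E 1 2 2 15 4 3 2 3 [],
    E 1 1 2 5 12 2 2 2 [],
    E 1 1 4 5 12 2 1 2 [],
    E 1 8 4 9 5 7 2 7 [(99,1,0),(81,0,1),(6,0,1),(87,0,1),(100,0,1),(91,3,1),(5,3,4),(3,3,1),
     (115,3,0),(2,3,1),(1,6,1),(0,6,1)],
    E 2 11 3 6 4 5 2 5 [(96,1,3),(112,1,1)],
    E 2 4 3 3 11 2 2 2 [],
    E 1 4 2 3 11 2 1 2 [],
    E 3 9 3 10 4 7 2 9 [(50,1,2),(126,0,3),(13,0,0),(12,0,0),(11,0,4),(3,3,1),(11,3,3),(2,3,0),
     (12,3,2),(13,3,2),(1,6,5),(0,6,5)],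
    E 2 8 3 9 4 12 1 9 [(190,1,4),(189,0,0),(30,0,0),(22,0,2),(163,0,2),(26,0,0),(68,3,1),
     (178,3,0),(176,3,0),(174,3,0),(173,3,0),(172,6,5)],
    E 2 3 5 8 7 6 5 6 [(50,3,3),(1,1,0),(0,5,2)],
    E 2 7 3 5 4 4 2 4 [(116,1,1)],
    E 2 12 3 6 4 5 2 5 [(103,1,3),(119,1,1)],
    E 2 4 3 3 12 2 2 2 [],
    E 1 4 2 3 12 2 1 2 [],
    E 3 8 4 9 4 11 2 9 [(7,1,3),(8,1,3),(125,0,3),(3,0,2),(9,0,2),(123,0,0),(6,3,2),(102,3,3),
     (2,3,2),(126,3,0),(20,3,2),(1,6,3),(0,6,3)],
    E 2 8 3 11 4 9 1 9 [(38,1,2),(196,0,0),(37,0,0),(35,0,0),(34,0,0),(24,3,2),(183,3,0),(182,3,0),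
     (181,3,0),(180,3,0),(179,6,5)],
    E 3 4 4 9 8 8 3 8 [(23,3,2),(6,1,1),(1,1,5),(0,5,4)],
    E 1 6 2 3 6 2 1 2 [],
    E 2 6 3 3 6 2 2 2 [],
    E 2 6 3 4 6 3 2 3 [],
    E 1 4 2 3 6 2 1 2 [],
    E 2 4 3 3 6 2 2 2 [],
    E 2 8 3 6 6 5 2 5 [(136,1,1)],
    E 2 12 3 7 7 6 2 6 [(144,0,5),(99,1,1),(25,1,2)],
    E 2 13 3 5 4 4 2 4 [(130,1,1)],
    E 3 7 3 8 4 10 2 8 [(4,1,5),(3,1,5),(141,0,0),(14,0,0),(2,0,3),(142,3,0),(1,3,0),(13,3,0),
     (0,3,0),(136,3,0),(12,6,5),(11,6,5)],
    E 2 13 3 6 6 5 2 5 [(140,1,1)],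
    E 2 13 3 5 6 4 2 4 [(133,1,1)],
    E 2 13 3 4 6 3 2 3 [],
    E 2 6 3 3 13 2 2 2 [],
    E 1 6 2 3 13 2 1 2 [],
    E 3 7 3 9 6 8 2 8 [(13,1,5),(12,0,0),(11,0,0),(157,0,0),(5,3,1),(35,3,2),(4,3,0),(3,3,0),
     (2,3,0),(1,6,5),(0,6,5)],
    E 3 3 4 8 9 7 3 7 [(23,0,2),(0,1,0)],
    E 4 7 6 5 7 8 4 5 [(92,1,2)],
    E 2 7 3 8 4 11 1 8 [(216,1,4),(215,0,0),(214,0,0),(54,0,0),(189,0,3),(25,0,0),(206,3,1),
     (204,3,0),(201,3,0),(200,3,0),(199,3,0),(198,6,5)],
    E 3 8 7 10 9 6 3 6 [(1,0,2),(1,1,2),(0,1,2)],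
    E 3 9 5 5 6 8 3 5 [(90,0,0),(71,1,0)],
    E 1 1 4 9 5 6 1 6 [(121,0,0)],
    E 3 8 4 4 9 10 3 4 [(122,0,2),(175,1,0),(0,1,4)],
    E 2 5 3 3 9 10 2 3 [(234,1,0)],
    E 1 3 1 4 2 6 2 4 [(87,1,1),(134,1,1)],
    E 1 1 6 7 11 2 1 2 [],
    E 1 7 1 9 7 8 2 8 [(142,1,1),(141,0,0),(14,0,3),(126,0,2),(159,3,5),(124,3,2),(97,3,3),(1,3,2),
     (121,3,0),(120,6,1),(0,6,1)],
    E 4 4 7 9 9 6 4 6 [(0,0,0),(67,0,0),(160,1,2)],
    E 1 6 2 4 4 7 1 4 [(47,1,4)],
    E 1 6 4 8 5 5 1 5 [(190,0,1)],
    E 1 4 4 4 12 1 1 1 [],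
    E 2 8 4 9 4 12 1 9 [(57,1,3),(58,0,2),(59,0,2),(2,0,2),(1,0,4),(56,3,2),(210,3,1),(60,3,1),
     (202,3,1),(62,3,2),(33,3,3),(0,6,5)],
    E 2 10 3 6 4 5 2 5 [(140,1,3),(156,1,1)],
    E 3 8 4 9 5 12 2 9 [(167,1,3),(168,1,3),(177,0,2),(164,0,0),(156,0,0),(146,0,1),(41,3,2),
     (53,3,2),(0,3,3),(172,3,2),(180,6,3),(181,6,3)],
    E 4 3 5 8 10 7 4 7 [(2,3,2),(0,0,2),(0,1,0)],
    E 2 3 3 3 7 2 2 2 [],
    E 2 17 3 4 4 3 2 3 [],
    E 3 6 4 9 7 7 2 7 [(149,1,5),(183,0,1),(186,0,0),(27,0,0),(175,3,3),(29,3,2),(41,3,3),(42,3,3),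
     (0,3,3),(40,6,2),(39,6,2)],
    E 2 12 3 3 3 4 2 3 [(183,1,1)],
    E 1 1 2 3 12 2 1 2 [],
    E 3 8 3 10 10 9 2 9 [(4,1,5),(62,0,0),(183,0,0),(33,0,0),(176,0,0),(2,3,0),(60,3,0),(181,3,0),
     (168,3,1),(1,3,1),(0,6,5)],
    E 1 2 3 7 5 11 1 7 [(233,1,1),(231,1,0)],
    E 1 2 2 6 3 5 1 5 [(164,1,0)],
    E 1 12 2 3 3 5 1 3 [],
    E 1 9 3 3 12 1 1 1 [],
    E 2 8 3 11 9 9 1 9 [(163,0,0),(83,0,0),(81,0,0),(80,0,0),(79,0,0),(68,3,0),(3,3,5),(2,3,3),
     (228,3,1),(1,3,1),(0,6,5)],
    E 4 9 6 7 8 11 4 7 [(53,3,0),(11,1,2),(5,1,3),(0,5,4)],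
    E 1 5 4 10 5 7 1 7 [(241,1,3),(133,1,3)],
    E 3 10 4 5 4 8 1 8 [(215,0,0),(244,0,2),(231,0,3),(77,0,0),(0,0,2),(73,0,3),(234,3,2),
     (232,3,2),(231,3,2),(230,3,2),(229,3,2),(228,6,3)],
    E 1 6 2 4 7 3 1 3 [(219,1,0)],
    E 2 4 3 4 6 3 2 3 [],
    E 3 6 4 4 7 3 3 3 [(21,0,0)],
    E 3 8 4 5 6 4 3 4 [(194,1,5)],
    E 3 7 7 9 9 5 3 5 [(190,0,2),(138,1,1)],
    E 2 1 3 7 8 6 2 6 [(230,0,0),(104,1,0)],
    E 1 5 3 11 7 9 3 5 [(256,0,3),(255,1,1),(0,1,1)],
    E 3 4 4 4 7 3 3 3 [(178,0,0)],
    E 2 6 3 4 12 3 2 3 [(268,1,0)],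
    E 1 6 2 4 12 3 1 3 [(228,1,0)],
    E 4 8 4 10 6 9 3 9 [(9,1,5),(8,1,0),(7,1,5),(6,0,0),(5,0,1),(39,3,4),(3,3,3),(6,3,2),(2,6,2),
     (1,6,5),(0,6,5)],
    E 1 3 2 2 8 1 1 1 [],
    E 1 2 3 4 4 7 1 4 [],
    E 1 2 2 6 6 11 1 6 [(226,1,3)],
    E 1 17 2 8 5 7 1 7 [(255,1,1),(257,1,3),(266,1,0)],
    E 1 17 3 5 4 8 1 5 [(249,1,0)],
    E 1 11 3 4 8 11 1 4 [(161,1,0)],
    E 1 8 3 3 11 1 1 1 [],
    E 2 9 3 11 8 2 1 9 [(6,1,4),(263,0,0),(5,0,5),(24,0,3),(4,0,3),(266,0,3),(3,3,5),(2,3,5),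
     (1,3,0),(236,3,3),(222,3,3),(0,6,5)],
    E 3 8 4 11 8 1 1 8 [(265,0,2),(264,0,3),(114,0,4),(253,0,3),(258,0,3),(0,0,0),(256,3,5),
     (254,3,3),(2,3,2),(250,3,3),(249,3,3),(235,6,5)],
    E 4 4 5 9 7 8 4 8 [(20,3,2),(195,3,2),(9,1,0),(195,5,2),(0,5,2)],
    E 3 8 3 10 4 9 2 9 [(79,1,3),(34,1,0),(92,0,0),(75,0,0),(193,0,1),(183,0,1),(32,3,0),(90,3,3),
     (74,3,0),(198,3,1),(92,3,2),(73,6,5),(72,6,5)],
    E 5 8 7 6 8 9 5 6 [(25,3,2),(0,1,5),(25,5,1)],
    E 4 9 8 11 10 7 4 7 [(95,3,2),(0,0,2),(0,1,2),(1,1,4)],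
    E 3 3 4 7 7 6 3 6 [(148,0,3),(239,1,4)],
    E 1 4 4 4 7 1 1 1 [],
    E 1 8 2 4 5 3 1 3 [],
    E 1 4 4 8 5 5 1 5 [],
    E 1 12 4 7 5 4 1 4 [(236,0,0)],
    E 1 11 2 3 5 2 1 2 [],
    E 1 5 4 4 12 1 1 1 [],
    E 2 8 4 11 5 4 1 8 [(5,1,4),(277,0,1),(4,0,2),(3,0,5),(114,0,1),(137,3,2),(144,3,0),(145,3,2),
     (2,3,0),(4,3,2),(1,3,2),(0,6,5)],
    E 4 9 5 5 7 8 4 5 [(7,0,2),(7,1,4),(0,1,4)],
    E 3 6 9 4 9 10 3 4 [(246,1,1),(290,1,3)],
    E 2 2 8 4 8 10 2 4 [(268,0,1)],
    E 1 4 2 4 5 3 1 3 [],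
    E 3 7 4 4 7 3 3 3 [],
    E 1 2 2 7 11 6 1 6 [(250,1,2)],
    E 2 4 3 8 4 5 3 4 [(195,1,3),(0,1,1)],
    E 1 6 2 2 5 6 1 2 [],
    E 1 6 2 6 5 5 1 5 [(152,1,1)],
    E 1 14 2 8 5 7 1 7 [(282,1,1),(284,1,3),(293,1,0)],
    E 1 11 4 7 5 4 1 4 [(250,0,0)],
    E 1 5 4 4 11 1 1 1 [],
    E 2 9 4 8 5 4 1 8 [(260,0,1),(290,0,1),(17,0,2),(158,0,2),(286,0,3),(2,3,2),(158,3,2),
     (264,3,3),(1,3,0),(17,3,2),(14,3,2),(0,6,5)],
    E 1 12 2 7 5 6 1 6 [(258,1,4),(195,1,0)],
    E 2 7 2 9 5 8 1 8 [(163,1,4),(6,0,0),(162,0,0),(5,0,0),(1,3,0),(0,3,0),(157,3,0),(156,3,0),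
     (155,3,0),(154,3,0),(153,6,5)],
    E 3 10 4 7 7 6 3 6 [(22,1,1),(0,1,5)],
    E 5 7 7 5 8 8 5 5 [(154,0,5),(154,1,3)],
    E 4 8 7 9 8 6 4 6 [(0,0,0),(105,1,3)],
    E 2 10 3 7 5 9 1 9 [(167,1,1),(247,0,3),(144,0,0),(7,0,0),(285,0,0),(3,0,2),(8,3,2),(161,3,2),
     (160,3,2),(159,3,2),(158,3,2),(157,6,3)],
    E 3 11 4 8 7 7 3 7 [(1,1,4),(84,1,5),(0,1,4)],
    E 3 9 4 6 7 5 3 5 [(121,1,5)],
    E 1 3 4 5 5 9 1 5 [],
    E 3 7 4 4 11 3 3 3 [(0,1,0)],
    E 1 7 2 4 12 3 1 3 [(274,1,0)],
    E 4 8 4 10 7 9 3 9 [(20,1,0),(244,1,2),(19,0,0),(17,0,3),(8,0,2),(4,3,0),(3,3,2),(82,3,2),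
     (1,6,5),(54,6,2),(0,6,5)],
    E 5 9 7 7 8 10 5 7 [(37,3,2),(0,1,3),(107,5,2),(87,5,2)],
    E 1 2 3 5 7 3 1 3 [],
    E 3 5 7 3 9 9 3 3 [(217,1,0)],
    E 3 7 5 4 5 6 3 4 [(251,0,0),(161,1,0)],
    E 3 8 5 6 6 9 3 6 [(183,1,3),(41,1,4)],
    E 3 3 4 5 5 7 3 5 [(300,0,0),(302,1,3),(197,1,0)],
    E 2 2 3 4 6 3 2 3 [],
    E 1 1 3 5 12 3 1 3 [],
    E 4 8 5 11 10 9 3 9 [(6,1,5),(5,1,2),(4,0,1),(58,0,0),(3,0,0),(54,3,1),(13,3,0),(2,3,3),
     (91,3,2),(1,6,3),(0,6,5)],
    E 1 2 2 4 7 3 1 3 [(285,1,0)],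
    E 3 9 4 6 5 5 3 5 [(305,1,3),(167,1,0)],
    E 2 2 3 4 12 3 2 3 [(154,1,0)],
    E 1 1 2 4 12 3 1 3 [],
    E 4 8 4 10 10 9 3 9 [(3,1,5),(62,1,5),(96,0,0),(63,0,0),(22,0,2),(18,3,0),(22,3,3),(2,3,2),
     (96,3,2),(1,6,5),(0,6,5)],
    E 5 5 6 9 9 8 5 8 [(308,3,5),(189,3,2),(5,3,4),(0,5,4),(189,5,2),(72,5,4)],
    E 2 8 2 9 3 6 1 8 [(160,1,3),(154,0,0),(152,0,0),(156,0,1),(300,3,1),(309,3,4),(307,3,4),
     (305,3,1),(55,3,4),(77,3,0),(145,3,0),(76,3,4)],
    E 3 8 4 5 4 11 1 8 [(320,1,1),(318,0,2),(60,0,2),(80,0,2),(122,0,1),(296,3,1),(308,3,2),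
     (305,3,2),(278,3,2),(303,3,2),(302,6,3)],
    E 6 8 8 6 9 9 6 6 [(0,3,4),(52,3,1),(52,5,4),(0,5,1)],
    E 3 9 4 7 4 11 2 9 [(133,1,2),(134,1,2),(270,0,2),(129,0,2),(301,0,2),(136,3,0),(128,3,2),
     (145,3,3),(146,3,3),(127,6,3),(126,6,3)],
    E 2 8 3 6 4 11 1 8 [(323,1,4),(322,0,0),(321,0,0),(296,0,5),(25,3,0),(313,3,1),(311,3,0),
     (308,3,0),(307,3,0),(306,3,0),(305,6,5)],
    E 5 8 8 10 9 7 5 7 [(4,3,0),(20,0,0),(2,0,0),(1,5,1),(0,5,1)],
    E 4 3 5 8 7 7 4 7 [(95,3,4),(253,0,2),(265,1,0),(127,5,2)],
    E 1 3 2 3 7 2 1 2 [],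
    E 2 7 3 3 3 4 2 3 [(67,1,0)],
    E 2 7 3 5 8 4 2 4 [(291,1,2)],
    E 2 12 3 6 8 5 2 5 [(294,1,0),(338,1,1)],
    E 2 12 3 5 8 4 2 4 [(293,1,2)],
    E 2 3 3 3 12 2 2 2 [],
    E 1 3 2 3 12 2 1 2 [],
    E 3 8 3 9 3 10 2 9 [(6,1,4),(99,1,4),(5,0,0),(4,0,1),(128,0,4),(248,0,0),(233,3,4),(127,3,1),
     (3,3,1),(2,3,0),(96,3,1),(1,6,5),(0,6,5)],
    E 5 8 6 6 8 9 5 6 [(68,3,2),(8,1,3),(0,1,5),(159,5,1)],
    E 4 7 8 9 10 5 4 5 [(303,0,1),(119,1,0),(209,1,1)],
    E 2 5 3 3 7 9 3 5 [(221,0,0),(340,1,0)],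
    E 1 1 2 5 6 10 1 5 [(300,1,0)],
    E 2 1 3 8 6 7 2 7 [(213,1,3)],
    E 2 3 3 8 8 7 2 7 [(0,1,0)],
    E 1 8 5 10 7 6 1 6 [(131,0,2),(306,0,0),(304,1,1)],
    E 2 8 3 11 8 9 1 9 [(182,1,2),(181,0,0),(179,0,0),(178,0,0),(177,0,0),(75,3,0),(207,3,0),
     (327,3,1),(77,3,0),(298,3,3),(76,6,5)],
    E 3 2 5 8 8 13 3 8 [(0,3,2),(73,0,0),(109,1,1),(76,5,1)],
    E 5 7 7 5 10 10 7 7 [(2,3,2),(243,3,1),(0,3,3),(0,5,5),(157,5,1),(2,5,0)],
    E 2 1 4 7 6 11 2 7 [(127,0,0),(250,1,1)],
    E 6 10 9 11 10 8 6 8 [(164,3,1),(5,3,5),(1,0,4),(2,5,2),(0,5,2),(164,5,1)],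
    E 2 12 4 6 7 11 2 6 [(336,0,0),(240,1,1),(350,1,1)],
    E 3 7 4 8 4 10 2 8 [(144,1,3),(143,1,3),(281,0,2),(280,0,1),(272,0,0),(13,0,0),(139,3,1),
     (0,3,1),(278,3,0),(140,3,2),(276,3,2),(159,6,3),(158,6,3)],
    E 6 9 8 7 9 10 6 7 [(236,3,2),(134,3,4),(35,5,0),(0,5,2),(340,5,3)],
    E 3 7 4 10 8 8 2 8 [(111,1,3),(112,0,4),(172,0,2),(19,0,2),(15,0,3),(284,3,0),(2,3,0),(20,3,2),
     (114,3,3),(161,6,2),(160,6,2)],
    E 6 9 9 10 10 7 6 7 [(327,3,4),(136,3,0),(1,1,2),(0,5,0),(342,5,2)],
    E 2 6 3 5 6 4 2 4 [(110,1,1)],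
    E 3 7 3 8 6 12 2 8 [(152,1,5),(151,0,0),(150,0,0),(0,0,0),(296,0,0),(162,3,2),(138,3,2),
     (146,3,0),(143,3,0),(142,3,0),(140,6,5),(139,6,5)],
    E 1 11 3 5 5 9 1 5 [(218,1,1)],
    E 2 9 2 10 3 7 1 9 [(95,1,5),(211,0,0),(201,0,4),(339,0,4),(342,0,4),(65,3,5),(342,3,1),
     (0,3,1),(339,3,1),(201,3,1),(211,3,2),(95,6,3)],
    E 4 7 6 6 7 9 4 6 [(141,0,0),(2,1,3),(0,1,0)],
    E 2 2 7 11 8 6 2 6 [(310,0,0),(363,0,2)],
    E 1 3 4 8 8 6 4 6 [(215,0,0),(59,1,2)],
    E 3 9 7 7 8 12 3 7 [(61,0,0),(0,1,1),(114,1,5)],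
    E 1 1 5 11 11 7 1 7 [(231,0,4),(361,0,0)],
    E 2 4 7 11 10 6 2 6 [(245,0,0),(247,1,1)],
    E 4 2 6 8 8 12 4 8 [(144,3,5),(164,3,2),(103,0,3),(57,1,5),(144,5,0)],
    E 1 14 3 5 4 8 1 5 [(349,1,0)],
    E 3 7 3 9 4 12 1 9 [(72,0,1),(346,0,2),(203,0,0),(348,0,2),(199,0,0),(146,0,0),(241,3,4),
     (199,3,3),(0,3,0),(361,3,2),(362,3,2),(363,6,1)],
    E 3 5 7 11 9 7 3 7 [(0,0,2),(11,0,3),(235,1,2)],
    E 2 4 5 9 12 6 2 6 [(319,0,1),(371,1,2)],
    E 1 3 4 8 9 5 1 5 [],
    E 1 3 7 5 10 14 1 5 [(0,1,0)],
    E 7 10 9 8 10 11 7 8 [(354,3,2),(7,3,0),(69,3,4),(6,5,5),(3,5,0),(2,5,1),(0,5,4)],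
    E 1 2 4 7 7 4 1 4 [],
    E 1 2 3 3 9 4 3 4 [(380,0,0)],
    E 1 2 3 7 9 4 3 4 [(381,0,0),(0,1,0)],
    E 4 7 6 6 7 4 4 4 [(35,0,0),(352,1,5)],
    E 2 3 4 7 7 5 4 5 [(354,0,0),(157,1,3),(81,1,4)],
    E 2 4 4 8 10 6 4 6 [(183,0,0),(78,0,0),(26,1,5),(10,1,5)],
    E 2 4 4 10 7 7 4 4 [(377,1,1),(379,1,1)],
    E 1 2 3 5 5 4 3 4 [(279,1,1)],
    E 2 2 3 5 8 4 2 4 [],
    E 1 2 4 7 12 4 1 4 [],
    E 2 10 5 8 7 11 4 8 [(9,1,1),(97,1,0),(7,1,1),(6,0,2),(5,0,0),(23,0,2),(4,3,1),(3,3,0),(2,6,0),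
     (1,6,0),(0,6,1)],
    E 1 1 6 8 8 3 1 3 [],
    E 2 1 7 8 8 3 2 3 [(121,0,0)],
    E 3 8 4 6 4 10 2 8 [(179,1,3),(187,0,2),(316,0,2),(307,0,0),(174,3,1),(309,3,5),(313,3,0),
     (175,3,2),(311,3,2),(194,6,3),(193,6,3)],
    E 3 8 6 10 7 7 3 7 [(242,0,0),(27,0,0),(0,1,0),(227,1,1)],
    E 1 2 3 6 6 4 3 4 [(7,1,1)],
    E 1 3 2 1 6 4 2 4 [],
    E 1 1 1 3 3 16 3 3 [(0,1,3)],
    E 1 10 6 11 8 8 3 8 [(6,1,1),(5,1,1),(166,0,4),(133,0,0),(78,0,3),(3,0,0),(129,0,3),(2,3,1),
     (0,3,0),(5,6,1),(6,6,1)],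
    E 1 3 2 8 5 4 2 4 [(344,1,1)],
    E 1 5 2 14 7 6 2 6 [(392,0,2),(137,1,5),(382,1,0)],
    E 2 7 5 8 6 5 2 5 [(104,0,0)],
    E 1 3 2 11 5 4 2 4 [(403,1,0)],
    E 1 2 2 14 4 3 2 3 [],
    E 1 1 2 5 11 2 2 2 [],
    E 1 9 4 10 5 8 2 8 [(312,1,1),(210,1,1),(355,0,1),(5,0,0),(309,0,0),(208,0,0),(4,3,1),(3,3,4),
     (2,3,0),(1,3,1),(0,6,1),(170,6,0)],
    E 1 8 3 5 4 8 1 5 [(382,1,0)],
    E 4 6 7 7 8 4 4 4 [(398,1,1)],
    E 1 6 3 9 11 7 1 7 [(0,0,1),(60,1,0),(374,1,0)],
    E 3 1 5 4 5 6 3 4 [(308,0,2)],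
    E 1 11 3 6 6 11 1 6 [(0,1,0),(409,1,1)],
    E 1 11 2 3 3 5 1 3 [],
    E 1 10 3 3 11 1 1 1 [],
    E 2 9 3 6 10 8 1 8 [(286,1,5),(259,0,3),(119,0,2),(6,0,0),(4,0,2),(370,3,1),(392,3,0),(2,3,0),
     (161,3,3),(138,3,0),(1,3,1),(0,6,5)]]"
    by code_simp
  from cops_win_if_certify[OF this] show ?thesis
    by (simp add: numeral_3_eq_3)
qed

theorem theorem1p2:
  fixes n :: nat
  assumes "7 \<le> n" and "n \<le> 18"
  shows "cop_number (queen_graph n) = 3"
proof -
  have "n = 7 \<or> n = 8 \<or> n = 9 \<or> n = 10 \<or> n = 11 \<or> n = 12 \<or>
      n = 13 \<or> n = 14 \<or> n = 15 \<or> n = 16 \<or> n = 17 \<or> n = 18"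
    using assms by presburger
  then have "cops_win (queen_graph n) 3"
    using cops_win_7 cops_win_8 cops_win_9 cops_win_10 cops_win_11 cops_win_12
      cops_win_13 cops_win_14 cops_win_15 cops_win_16 cops_win_17 cops_win_18
    by (elim disjE) simp_all
  \<comment> \<open>\<open>Least_equality\<close> asks for a lower bound on every winning
    \<open>k\<close>, hence for the failure of 0, 1 and 2 cops alike.\<close>
  moreover have "3 \<le> k" if "cops_win (queen_graph n) k" for k
    using that not_cops_win_queen_graph[OF assms(1), of k] by force
  ultimately show ?thesis
    unfolding cop_number_def by (rule Least_equality)
qed

end
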